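(* Let $\mathfrak m_2$ be the infinite dimensional $\mathbb N$-graded Lie algebra over $\mathbb K$ ($\mathbb K=\mathbb R$ or $\mathbb C$) with basis $(e_i)_{i\ge 1}$ and only non-trivial brackets (up to antisymmetry) $[e_1,e_i]=e_{i+1}$ for $i\ge 2$ and $[e_2,e_j]=e_{j+2}$ for $j\ge 3$. For $l\in\mathbb Z$ let $H^2_l(\mathfrak m_2,\mathfrak m_2)$ be the weight $l$ part of its second adjoint cohomology. Then $$\dim H^2_l(\mathfrak m_2,\mathfrak m_2)=\begin{cases}0 & \text{for } l\le -5,\\ 1 & \text{for } l=-1,0,1,\\ 2 & \text{for } l=-4,-3,-2 \text{ or } l\ge 2.\end{cases}$$
   Context: Cohomology is Lie algebra cohomology with coefficients in the adjoint representation. A $p$-cochain is homogeneous of weight $l\in\mathbb Z$ if it maps $(e_{i_1},\dots,e_{i_p})$ to a multiple of $e_{i_1+\cdots+i_p+l}$ (with $e_k:=0$ for $k\le 0$). $H^2_l$ is the quotient of the homogeneous $2$-cocycles of weight $l$ by the coboundaries of homogeneous $1$-cochains of weight $l$. *)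

theory Defs
  imports "Jordan_Normal_Form.VS_Connect" "HOL-Algebra.AbelCoset"
    "HOL-Library.Poly_Mapping" Complex_Main
begin

section \<open>The graded Lie algebra \<open>m\<^sub>2\<close>\<close>

text \<open>The basis is indexed from 1 on paper and from 0 here: for \<open>x :: 'k m2\<close>, \<open>lookup x n\<close> is
  the coefficient of \<open>e\<^bsub>n+1\<^esub>\<close>.\<close>

type_synonym 'k m2 = "nat \<Rightarrow>\<^sub>0 'k"

definition m2_scale :: "'k::field \<Rightarrow> 'k m2 \<Rightarrow> 'k m2" where
  "m2_scale c x = Poly_Mapping.map ((*) c) x"

definition m2_e :: "int \<Rightarrow> 'k::field m2" where
  "m2_e k = (if k \<le> 0 then 0 else Poly_Mapping.single (nat k - 1) 1)"

text \<open>Brackets of basis vectors; every nonzero one is \<open>\<plusminus> e\<^bsub>i+j\<^esub>\<close>.\<close>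

definition m2_basis_bracket :: "nat \<Rightarrow> nat \<Rightarrow> 'k::field m2" where
  "m2_basis_bracket i j =
     (if i = 1 \<and> j \<ge> 2 \<or> i = 2 \<and> j \<ge> 3 then m2_e (int (i + j))
      else if j = 1 \<and> i \<ge> 2 \<or> j = 2 \<and> i \<ge> 3 then - m2_e (int (i + j))
      else 0)"

definition m2_bracket :: "'k::field m2 \<Rightarrow> 'k m2 \<Rightarrow> 'k m2" where
  "m2_bracket x y =
     (\<Sum>i\<in>Poly_Mapping.keys x. \<Sum>j\<in>Poly_Mapping.keys y.
        m2_scale (Poly_Mapping.lookup x i * Poly_Mapping.lookup y j)
          (m2_basis_bracket (i + 1) (j + 1)))"

lemma lookup_m2_scale [simp]:
  "Poly_Mapping.lookup (m2_scale c x) n = c * Poly_Mapping.lookup x n"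
  by (simp add: m2_scale_def map.rep_eq when_def)

lemma vector_space_m2: "vector_space (m2_scale :: 'k::field \<Rightarrow> _)"
  by unfold_locales (simp_all add: poly_mapping_eq_iff fun_eq_iff lookup_add algebra_simps)

interpretation m2: vector_space "m2_scale :: 'k::field \<Rightarrow> _"
  by (rule vector_space_m2)

lemma m2_e_nat: "m2_e (int n + 1) = Poly_Mapping.single n 1"
  by (simp add: m2_e_def nat_add_distrib)

lemma m2_expansion:
  "(\<Sum>i\<in>Poly_Mapping.keys x. m2_scale (Poly_Mapping.lookup x i) (m2_e (int i + 1))) = x"
proof (rule poly_mapping_eqI)
  fix n
  show "Poly_Mapping.lookup (\<Sum>i\<in>Poly_Mapping.keys x.
      m2_scale (Poly_Mapping.lookup x i) (m2_e (int i + 1))) n = Poly_Mapping.lookup x n"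
    by (simp add: lookup_sum m2_e_nat lookup_single when_def in_keys_iff
        if_distrib[of "\<lambda>t. _ * t"] cong: if_cong)
qed

lemma m2_bracket_superset:
  assumes "finite A" "finite B" "Poly_Mapping.keys x \<subseteq> A" "Poly_Mapping.keys y \<subseteq> B"
  shows "m2_bracket x y = (\<Sum>i\<in>A. \<Sum>j\<in>B.
        m2_scale (Poly_Mapping.lookup x i * Poly_Mapping.lookup y j)
          (m2_basis_bracket (i + 1) (j + 1)))"
proof -
  let ?f = "\<lambda>i j. m2_scale (Poly_Mapping.lookup x i * Poly_Mapping.lookup y j)
          (m2_basis_bracket (i + 1) (j + 1))"
  have "m2_bracket x y = (\<Sum>i\<in>Poly_Mapping.keys x. \<Sum>j\<in>B. ?f i j)"
    unfolding m2_bracket_def using assms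
    by (intro sum.cong refl sum.mono_neutral_left) (auto simp: in_keys_iff)
  also have "\<dots> = (\<Sum>i\<in>A. \<Sum>j\<in>B. ?f i j)"
    using assms by (intro sum.mono_neutral_left) (auto simp: in_keys_iff)
  finally show ?thesis .
qed

lemma m2_bracket_add_left: "m2_bracket (x + x') y = m2_bracket x y + m2_bracket x' y"
proof -
  let ?A = "Poly_Mapping.keys x \<union> Poly_Mapping.keys x' \<union> Poly_Mapping.keys (x + x')"
  let ?B = "Poly_Mapping.keys y"
  show ?thesis
    by (subst (1 2 3) m2_bracket_superset[of ?A ?B])
       (auto simp: sum.distrib lookup_add distrib_right m2.scale_left_distrib)
qed

lemma m2_bracket_scale_left: "m2_bracket (m2_scale c x) y = m2_scale c (m2_bracket x y)"
proof -
  let ?A = "Poly_Mapping.keys x \<union> Poly_Mapping.keys (m2_scale c x)"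
  let ?B = "Poly_Mapping.keys y"
  show ?thesis
    by (simp add: m2_bracket_superset[of ?A ?B] m2.scale_sum_right mult.assoc)
qed

lemma m2_basis_bracket_swap: "m2_basis_bracket j i = - m2_basis_bracket i j"
  by (auto simp: m2_basis_bracket_def add.commute)

lemma m2_bracket_antisym: "m2_bracket y x = - m2_bracket x y"
  unfolding m2_bracket_def
  by (subst sum.swap, subst m2_basis_bracket_swap)
     (simp add: sum_negf[symmetric] mult.commute)

lemma m2_bracket_e:
  assumes "i \<ge> 1" "j \<ge> 1"
  shows "m2_bracket (m2_e i) (m2_e j) = m2_basis_bracket (nat i) (nat j)"
  using assms by (simp add: m2_bracket_def m2_e_def)

lemma m2_brackets:
  "i \<ge> 2 \<Longrightarrow> m2_bracket (m2_e 1) (m2_e i) = m2_e (i + 1)"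
  "j \<ge> 3 \<Longrightarrow> m2_bracket (m2_e 2) (m2_e j) = m2_e (j + 2)"
  "3 \<le> i \<Longrightarrow> 3 \<le> j \<Longrightarrow> m2_bracket (m2_e i) (m2_e j) = 0"
  by (simp_all add: m2_bracket_e m2_basis_bracket_def add.commute nat_eq_iff)

lemma m2_bracket_add_right: "m2_bracket x (y + y') = m2_bracket x y + m2_bracket x y'"
  by (subst (1 2 3) m2_bracket_antisym) (simp add: m2_bracket_add_left)

lemma m2_bracket_scale_right: "m2_bracket x (m2_scale c y) = m2_scale c (m2_bracket x y)"
  by (subst (1 2) m2_bracket_antisym) (simp add: m2_bracket_scale_left)

lemmas m2_bracket_simps =
  m2_bracket_add_left m2_bracket_scale_left m2_bracket_add_right m2_bracket_scale_right

lemma m2_bracket_zero_right: "m2_bracket x 0 = 0"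
  by (simp add: m2_bracket_def)

lemma m2_bracket_self: "m2_bracket x x = (0 :: 'k::field_char_0 m2)"
proof (rule poly_mapping_eqI)
  fix n
  have "Poly_Mapping.lookup (m2_bracket x x) n = - Poly_Mapping.lookup (m2_bracket x x) n"
    by (subst m2_bracket_antisym) simp
  then show "Poly_Mapping.lookup (m2_bracket x x) n = Poly_Mapping.lookup 0 n"
    by (simp add: eq_neg_iff_add_eq_0 flip: mult_2)
qed

lemma m2_linear_eq_0:
  assumes "Vector_Spaces.linear m2_scale m2_scale f" "\<And>i. i \<ge> 1 \<Longrightarrow> f (m2_e i) = 0"
  shows "f x = 0"
proof -
  interpret f: Vector_Spaces.linear m2_scale m2_scale f by fact
  have "f x = f (\<Sum>i\<in>Poly_Mapping.keys x. m2_scale (Poly_Mapping.lookup x i) (m2_e (int i + 1)))"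
    by (simp only: m2_expansion)
  also have "\<dots> = 0"
    by (simp add: f.sum f.scale assms(2))
  finally show ?thesis .
qed

lemma m2_jacobi_basis:
  assumes "i \<ge> 1" "j \<ge> 1" "k \<ge> 1"
  shows "m2_bracket (m2_e i) (m2_bracket (m2_e j) (m2_e k))
    + m2_bracket (m2_e j) (m2_bracket (m2_e k) (m2_e i))
    + m2_bracket (m2_e k) (m2_bracket (m2_e i) (m2_e j)) = 0"
proof -
  have neg: "m2_bracket x (- y) = - m2_bracket x y" for x y :: "'a m2"
    using m2_bracket_scale_right[of x "-1" y] by simp
  have eq: "m2_bracket (m2_e i) (m2_e j) =
      (if i = 1 \<and> j \<ge> 2 \<or> i = 2 \<and> j \<ge> 3 then m2_e (i + j)
       else if j = 1 \<and> i \<ge> 2 \<or> j = 2 \<and> i \<ge> 3 then - m2_e (i + j) else 0 :: 'a m2)"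
    if "i \<ge> 1" "j \<ge> 1" for i j
    using that by (auto simp: m2_bracket_e m2_basis_bracket_def nat_eq_iff le_nat_iff add.commute)
  have cases: "n = 1 \<or> n = 2 \<or> n \<ge> 3" if "n \<ge> 1" for n :: int
    using that by linarith
  show ?thesis
    using cases[OF assms(1)] cases[OF assms(2)] cases[OF assms(3)] assms
    by (elim disjE) (simp_all add: eq neg m2_bracket_zero_right algebra_simps)
qed

lemma m2_jacobi:
  "m2_bracket x (m2_bracket y z) + m2_bracket y (m2_bracket z x) + m2_bracket z (m2_bracket x y) = 0"
proof -
  let ?J = "\<lambda>x y z :: 'a m2. m2_bracket x (m2_bracket y z) + m2_bracket y (m2_bracket z x)
    + m2_bracket z (m2_bracket x y)"
  have lin: "Vector_Spaces.linear m2_scale m2_scale (\<lambda>x. ?J x y z)"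
    "Vector_Spaces.linear m2_scale m2_scale (\<lambda>y. ?J x y z)"
    "Vector_Spaces.linear m2_scale m2_scale (\<lambda>z. ?J x y z)" for x y z
    by (unfold_locales; simp add: m2_bracket_simps m2.scale_right_distrib)+
  show ?thesis
    by (rule m2_linear_eq_0[OF lin(1)], rule m2_linear_eq_0[OF lin(2)],
        rule m2_linear_eq_0[OF lin(3)]) (rule m2_jacobi_basis)
qed


section \<open>Adjoint cohomology in degree two\<close>

text \<open>A \<open>p\<close>-cochain is an alternating \<open>p\<close>-linear map with values in \<open>m\<^sub>2\<close>; the differentials are the
  Chevalley--Eilenberg ones for the adjoint action.\<close>

definition m2_cochain1 :: "('k::field m2 \<Rightarrow> 'k m2) \<Rightarrow> bool" where
  "m2_cochain1 \<phi> \<longleftrightarrow> Vector_Spaces.linear m2_scale m2_scale \<phi>"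

definition m2_cochain2 :: "('k::field m2 \<Rightarrow> 'k m2 \<Rightarrow> 'k m2) \<Rightarrow> bool" where
  "m2_cochain2 \<omega> \<longleftrightarrow>
     (\<forall>x. Vector_Spaces.linear m2_scale m2_scale (\<omega> x)) \<and>
     (\<forall>y. Vector_Spaces.linear m2_scale m2_scale (\<lambda>x. \<omega> x y)) \<and>
     (\<forall>x. \<omega> x x = 0)"

definition m2_d1 :: "('k::field m2 \<Rightarrow> 'k m2) \<Rightarrow> 'k m2 \<Rightarrow> 'k m2 \<Rightarrow> 'k m2" where
  "m2_d1 \<phi> x y = m2_bracket x (\<phi> y) - m2_bracket y (\<phi> x) - \<phi> (m2_bracket x y)"

definition m2_d2 ::
  "('k::field m2 \<Rightarrow> 'k m2 \<Rightarrow> 'k m2) \<Rightarrow> 'k m2 \<Rightarrow> 'k m2 \<Rightarrow> 'k m2 \<Rightarrow> 'k m2" where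
  "m2_d2 \<omega> x y z =
     m2_bracket x (\<omega> y z) - m2_bracket y (\<omega> x z) + m2_bracket z (\<omega> x y)
     - \<omega> (m2_bracket x y) z + \<omega> (m2_bracket x z) y - \<omega> (m2_bracket y z) x"

definition m2_weight1 :: "int \<Rightarrow> ('k::field m2 \<Rightarrow> 'k m2) \<Rightarrow> bool" where
  "m2_weight1 l \<phi> \<longleftrightarrow> (\<forall>i\<ge>1. \<exists>c. \<phi> (m2_e i) = m2_scale c (m2_e (i + l)))"

definition m2_weight2 :: "int \<Rightarrow> ('k::field m2 \<Rightarrow> 'k m2 \<Rightarrow> 'k m2) \<Rightarrow> bool" where
  "m2_weight2 l \<omega> \<longleftrightarrow>
     (\<forall>i\<ge>1. \<forall>j\<ge>1. \<exists>c. \<omega> (m2_e i) (m2_e j) = m2_scale c (m2_e (i + j + l)))"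

text \<open>In a \<open>module\<close> record the ring fields \<open>mult\<close> and \<open>one\<close> play no role.\<close>

definition m2_cocycles :: "int \<Rightarrow> ('k::field, 'k m2 \<Rightarrow> 'k m2 \<Rightarrow> 'k m2) module" where
  "m2_cocycles l =
     \<lparr> carrier = {\<omega>. m2_cochain2 \<omega> \<and> m2_weight2 l \<omega> \<and> (\<forall>x y z. m2_d2 \<omega> x y z = 0)},
       mult = undefined, one = undefined,
       zero = (\<lambda>x y. 0), add = (\<lambda>\<omega> \<eta> x y. \<omega> x y + \<eta> x y),
       smult = (\<lambda>c \<omega> x y. m2_scale c (\<omega> x y)) \<rparr>"

definition m2_coboundaries :: "int \<Rightarrow> ('k::field m2 \<Rightarrow> 'k m2 \<Rightarrow> 'k m2) set" where
  "m2_coboundaries l = m2_d1 ` {\<phi>. m2_cochain1 \<phi> \<and> m2_weight1 l \<phi>}"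

text \<open>The quotient of a module by a submodule, with the cosets as elements; the operations follow
  \<open>FactRing\<close>.\<close>

definition quotient_module :: "('a, 'b) module \<Rightarrow> 'b set \<Rightarrow> ('a, 'b set) module" where
  "quotient_module M N =
     \<lparr> carrier = a_rcosets\<^bsub>M\<^esub> N, mult = undefined, one = undefined,
       zero = N, add = set_add M,
       smult = (\<lambda>c X. \<Union>x\<in>X. N +>\<^bsub>M\<^esub> (c \<odot>\<^bsub>M\<^esub> x)) \<rparr>"

definition m2_H2 :: "int \<Rightarrow> ('k::field, ('k m2 \<Rightarrow> 'k m2 \<Rightarrow> 'k m2) set) module" where
  "m2_H2 l = quotient_module (m2_cocycles l) (m2_coboundaries l)"

text \<open>\<open>vectorspace.dim\<close> is meaningful only for finite-dimensional spaces.\<close>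

definition has_dim :: "('k::field, 'v) module \<Rightarrow> nat \<Rightarrow> bool" where
  "has_dim V n \<longleftrightarrow> vectorspace class_ring V \<and> vectorspace.fin_dim class_ring V
     \<and> vectorspace.dim class_ring V = n"

end

theory Submission
  imports Defs
begin

text \<open>
  A cochain of weight \<open>l\<close> is an array of scalars: \<open>\<omega> (e\<^sub>i, e\<^sub>j) = A i j \<cdot> e\<^bsub>i+j+l\<^esub>\<close>. A cocycle is
  first normalised by a coboundary; the cocycle equations then leave at most two free parameters.

  As \<open>[e\<^sub>1, e\<^sub>i] = e\<^bsub>i+1\<^esub>\<close> for \<open>i \<ge> 2\<close>, subtracting a suitable coboundary makes \<open>A 1 i = 0\<close> for
  all \<open>i\<close>: the \<open>1\<close>-cochain is put to \<open>0\<close> at \<open>e\<^sub>1\<close> and \<open>e\<^sub>2\<close>, and its value at \<open>e\<^bsub>i+1\<^esub>\<close> is solved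
  for in terms of its value at \<open>e\<^sub>i\<close> (\<open>normalized_cocycle\<close>).

  For a normalised cocycle, the equations of the triples \<open>(e\<^sub>1, e\<^sub>j, e\<^sub>k)\<close> and \<open>(e\<^sub>2, e\<^sub>j, e\<^sub>k)\<close> read
  \<open>A = S A + T A\<close> and \<open>A = S\<^sup>2 A + T\<^sup>2 A\<close>, where \<open>S\<close> and \<open>T\<close> shift the first and the second index,
  as long as the values of the cochain are multiples of \<open>e\<^sub>m\<close> with \<open>m \<ge> 3\<close>. Applying the first
  equation twice and comparing gives \<open>2 S T A = 0\<close>. So \<open>A j k\<close> vanishes for \<open>j, k \<ge> 4\<close>, and from \<open>k = 4\<close> on the row
  \<open>A 3 k\<close> is constant and the row \<open>A 2 k\<close> is affine. This leads to the fact that \<open>A 2 3\<close> and \<open>A 3 4\<close>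
  determine a normalised cocycle when \<open>l \<ge> -4\<close> (\<open>normalized_cocycle_zero\<close>). When \<open>l \<le> -5\<close>, these two
  entries have \<open>0\<close>, \<open>e\<^sub>1\<close> or \<open>e\<^sub>2\<close> as their target \<open>e\<^bsub>i+j+l\<^esub>\<close>, and the equations of triples with one
  large index make all entries with such a target vanish
  (\<open>normalized_cocycle_zero_if_le_minus_5\<close>).

  Conversely, for \<open>l \<ge> -4\<close> every pair of values of \<open>A 3 4\<close> and \<open>A 2 3\<close> occurs
  (\<open>cocycle_normal_form\<close>). For \<open>l = -3\<close> and \<open>l = -4\<close> the second equation has an extra term, and the row
  \<open>A 4 k\<close> becomes a constant multiple of \<open>A 2 3\<close>.

  Some coboundaries are already normalised. For \<open>l \<ge> -4\<close> these have \<open>A 3 4 = 0\<close>, and also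
  \<open>A 2 3 = 0\<close> unless \<open>l \<in> {-1, 0, 1}\<close>; for these three weights every value of \<open>A 2 3\<close> occurs
  (\<open>normalized_coboundary_zero\<close>, \<open>normalized_coboundary_exists\<close>).

  So the entries \<open>3 4\<close> and \<open>2 3\<close> of the normalised array are linear coordinates on the cohomology for
  \<open>l \<ge> -4\<close>, \<open>l \<notin> {-1, 0, 1}\<close>, the entry \<open>3 4\<close> alone is one for \<open>l \<in> {-1, 0, 1}\<close>, and for
  \<open>l \<le> -5\<close> every cocycle is a coboundary. The dimension of the quotient then follows from the first
  isomorphism theorem (\<open>has_dim_quotient_module\<close>).
\<close>

section \<open>Quotients by the kernel of a linear map\<close>

text \<open>The first isomorphism theorem: the cosets of the kernel are the fibres of \<open>F\<close>, so mapping
  a vector of the codomain to its fibre is an isomorphism onto the quotient. The vector space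
  axioms of the quotient are transported along this bijection.\<close>

lemma quotient_module_linear_iso:
  fixes M :: "('a, 'b) module"
  assumes F: "linear_map K M W F" and surj: "F ` carrier M = carrier W"
    and N: "N = {x \<in> carrier M. F x = \<zero>\<^bsub>W\<^esub>}"
  defines "G \<equiv> \<lambda>w. {x \<in> carrier M. F x = w}"
  shows "linear_map K W (quotient_module M N) G"
    and "inj_on G (carrier W)"
    and "G ` carrier W = carrier (quotient_module M N)"
proof -
  interpret F: linear_map K M W F by fact
  let ?Q = "quotient_module M N"
  have coset: "N +>\<^bsub>M\<^esub> x = G (F x)" if x: "x \<in> carrier M" for x
  proof (intro equalityI subsetI)
    fix y assume "y \<in> N +>\<^bsub>M\<^esub> x"
    then obtain n where "n \<in> N" "y = n \<oplus>\<^bsub>M\<^esub> x" by (auto simp: a_r_coset_def')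
    then show "y \<in> G (F x)" using x by (simp add: N G_def)
  next
    fix y assume "y \<in> G (F x)"
    then have y: "y \<in> carrier M" "F y = F x" by (auto simp: G_def)
    have "F (y \<oplus>\<^bsub>M\<^esub> \<ominus>\<^bsub>M\<^esub> x) = F (x \<oplus>\<^bsub>M\<^esub> \<ominus>\<^bsub>M\<^esub> x)" using x y by simp
    also have "\<dots> = \<zero>\<^bsub>W\<^esub>" using x by (simp add: F.V.module.M.r_neg)
    finally have "y \<oplus>\<^bsub>M\<^esub> \<ominus>\<^bsub>M\<^esub> x \<in> N" using x y by (simp add: N)
    moreover have "(y \<oplus>\<^bsub>M\<^esub> \<ominus>\<^bsub>M\<^esub> x) \<oplus>\<^bsub>M\<^esub> x = y"
      using x y by (simp add: F.V.module.M.a_assoc F.V.module.M.l_neg)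
    ultimately show "y \<in> N +>\<^bsub>M\<^esub> x" by (force simp: a_r_coset_def')
  qed
  have carrier: "G ` carrier W = carrier ?Q"
    by (auto simp: quotient_module_def A_RCOSETS_def' coset simp flip: surj)
  then show "G ` carrier W = carrier ?Q" .
  have lift: "\<exists>x \<in> carrier M. F x = w" if "w \<in> carrier W" for w
    using that unfolding surj[symmetric] by auto
  show inj: "inj_on G (carrier W)"
    using lift by (auto simp: inj_on_def G_def)
  have add: "add ?Q (G v) (G w) = G (v \<oplus>\<^bsub>W\<^esub> w)"
    if vw: "v \<in> carrier W" "w \<in> carrier W" for v w
  proof (intro equalityI subsetI)
    fix y assume "y \<in> add ?Q (G v) (G w)"
    then show "y \<in> G (v \<oplus>\<^bsub>W\<^esub> w)"
      by (auto simp: quotient_module_def set_add_def' G_def)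
  next
    fix y assume y: "y \<in> G (v \<oplus>\<^bsub>W\<^esub> w)"
    obtain x where x: "x \<in> carrier M" "F x = v" using lift vw(1) by auto
    obtain z where z: "z \<in> carrier M" "F z = w" using lift vw(2) by auto
    have "y \<in> N +>\<^bsub>M\<^esub> (x \<oplus>\<^bsub>M\<^esub> z)"
      using y x z coset[of "x \<oplus>\<^bsub>M\<^esub> z"] by simp
    then obtain n where n: "n \<in> N" "y = n \<oplus>\<^bsub>M\<^esub> (x \<oplus>\<^bsub>M\<^esub> z)" by (auto simp: a_r_coset_def')
    have "n \<in> carrier M" using n N by auto
    then have "y = (n \<oplus>\<^bsub>M\<^esub> x) \<oplus>\<^bsub>M\<^esub> z" using n x z by (simp add: F.V.module.M.a_assoc)
    moreover have "n \<oplus>\<^bsub>M\<^esub> x \<in> G v"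
      using n x vw N by (auto simp: G_def)
    moreover have "z \<in> G w" using z by (simp add: G_def)
    ultimately show "y \<in> add ?Q (G v) (G w)"
      by (auto simp: quotient_module_def set_add_def')
  qed
  have smult: "smult ?Q c (G w) = G (c \<odot>\<^bsub>W\<^esub> w)"
    if "c \<in> carrier K" "w \<in> carrier W" for c w
  proof -
    have "smult ?Q c (G w) = (\<Union>x\<in>G w. G (c \<odot>\<^bsub>W\<^esub> w))"
      unfolding quotient_module_def using that
      by (auto simp: G_def coset F.T_smult)
    then show ?thesis using lift[OF that(2)] by (auto simp: G_def)
  qed
  have zero: "\<zero>\<^bsub>?Q\<^esub> = G \<zero>\<^bsub>W\<^esub>" by (simp add: quotient_module_def N G_def)
  \<comment> \<open>Every operation of the quotient is now expressed through \<open>G\<close> and the operations of \<open>W\<close>.\<close>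
  have "module K ?Q"
  proof (rule module_criteria)
    show "cring K" by (rule F.V.module.R.cring_axioms)
    show "\<forall>v\<in>carrier ?Q. \<exists>u\<in>carrier ?Q. v \<oplus>\<^bsub>?Q\<^esub> u = \<zero>\<^bsub>?Q\<^esub>"
      unfolding carrier[symmetric] zero
      by (auto simp: add intro!: bexI[of _ "\<ominus>\<^bsub>W\<^esub> _"] simp: F.W.module.M.r_neg)
  qed (simp_all add: carrier[symmetric] zero, auto simp: add smult F.W.module.M.a_ac
      F.W.module.smult_assoc1 F.W.module.smult_l_distr F.W.module.smult_r_distr)
  then have "vectorspace K ?Q" using F.V.vectorspace_axioms by (simp add: vectorspace_def)
  then show "linear_map K W ?Q G"
    using F.W.vectorspace_axioms carrier
    by (auto simp: linear_map_def mod_hom_def mod_hom_axioms_def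
        LinearCombinations.module_hom_def vectorspace_def
        add smult)
qed

lemma has_dim_quotient_module:
  fixes F :: "'b \<Rightarrow> 'k::field vec"
  assumes F: "linear_map class_ring M (module_vec TYPE('k) n) F"
    and surj: "F ` carrier M = carrier_vec n"
    and N: "N = {x \<in> carrier M. F x = 0\<^sub>v n}"
  shows "has_dim (quotient_module M N) n"
proof -
  interpret W: vec_space "TYPE('k)" n .
  let ?G = "\<lambda>w. {x \<in> carrier M. F x = w}"
  have N': "N = {x \<in> carrier M. F x = \<zero>\<^bsub>module_vec TYPE('k) n\<^esub>}"
    by (simp add: N module_vec_simps)
  have surj': "F ` carrier M = carrier (module_vec TYPE('k) n)"
    by (simp add: surj module_vec_simps)
  note iso = quotient_module_linear_iso[OF F surj' N']
  interpret G: linear_map class_ring "module_vec TYPE('k) n" "quotient_module M N" ?G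
    by (rule iso(1))
  show ?thesis
    unfolding has_dim_def
    using G.W.vectorspace_axioms G.surj_fin_dim[OF W.fin_dim iso(3)]
      G.dim_eq[OF W.fin_dim iso(2,3)] W.dim_is_n by simp
qed

section \<open>Linear algebra in \<open>m\<^sub>2\<close>\<close>

definition m2_extend :: "(int \<Rightarrow> 'k::field m2) \<Rightarrow> 'k m2 \<Rightarrow> 'k m2" where
  "m2_extend f x = (\<Sum>i\<in>Poly_Mapping.keys x. m2_scale (Poly_Mapping.lookup x i) (f (int i + 1)))"

lemma m2_extend_superset:
  assumes "finite S" "Poly_Mapping.keys x \<subseteq> S"
  shows "m2_extend f x = (\<Sum>i\<in>S. m2_scale (Poly_Mapping.lookup x i) (f (int i + 1)))"
  unfolding m2_extend_def using assms
  by (intro sum.mono_neutral_left) (auto simp: in_keys_iff)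

lemma m2_linear_simps:
  assumes "Vector_Spaces.linear m2_scale m2_scale f"
  shows "f (x + y) = f x + f y" "f (x - y) = f x - f y" "f (- x) = - f x" "f 0 = 0"
    "f (m2_scale c x) = m2_scale c (f x)"
proof -
  interpret Vector_Spaces.linear m2_scale m2_scale f by fact
  show "f (x + y) = f x + f y" "f (x - y) = f x - f y" "f (- x) = - f x" "f 0 = 0"
    "f (m2_scale c x) = m2_scale c (f x)"
    by (rule add diff neg zero scale)+
qed

lemma m2_linearI:
  assumes "\<And>x y. f (x + y) = f x + f y" "\<And>c x. f (m2_scale c x) = m2_scale c (f x)"
  shows "Vector_Spaces.linear m2_scale m2_scale f"
  by unfold_locales (rule assms)+

lemma linear_m2_extend: "Vector_Spaces.linear m2_scale m2_scale (m2_extend f)"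
proof (unfold_locales)
  fix x y :: "'a m2" and c :: 'a
  let ?S = "Poly_Mapping.keys x \<union> Poly_Mapping.keys y \<union> Poly_Mapping.keys (x + y)"
  show "m2_extend f (x + y) = m2_extend f x + m2_extend f y"
    by (subst (1 2 3) m2_extend_superset[of ?S])
      (auto simp: lookup_add m2.scale_left_distrib sum.distrib)
  let ?T = "Poly_Mapping.keys x \<union> Poly_Mapping.keys (m2_scale c x)"
  show "m2_extend f (m2_scale c x) = m2_scale c (m2_extend f x)"
    by (simp add: m2_extend_superset[of ?T] m2.scale_sum_right)
qed

lemma m2_extend_e: "1 \<le> i \<Longrightarrow> m2_extend f (m2_e i) = f i"
  by (simp add: m2_extend_def m2_e_def)

lemma m2_bilinear_eq_0:
  assumes "\<And>x. Vector_Spaces.linear m2_scale m2_scale (\<omega> x)"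
    and "\<And>y. Vector_Spaces.linear m2_scale m2_scale (\<lambda>x. \<omega> x y)"
    and "\<And>i j. 1 \<le> i \<Longrightarrow> 1 \<le> j \<Longrightarrow> \<omega> (m2_e i) (m2_e j) = 0"
  shows "\<omega> x y = 0"
  by (rule m2_linear_eq_0[OF assms(2)], rule m2_linear_eq_0[OF assms(1)]) (rule assms(3))

lemma m2_e_eq_0_iff: "m2_e k = (0 :: 'k::field m2) \<longleftrightarrow> k \<le> 0"
  by (auto simp: m2_e_def dest: arg_cong[of _ _ Poly_Mapping.keys])

lemma m2_bracket_neg_right: "m2_bracket x (- y) = - m2_bracket x y"
  using m2_bracket_scale_right[of x "-1" y] by simp

lemma m2_bracket_diff_right: "m2_bracket x (y - z) = m2_bracket x y - m2_bracket x z"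
  using m2_bracket_add_right[of x y "- z"] by (simp add: m2_bracket_neg_right)

text \<open>The structure constants of \<open>m\<^sub>2\<close>. Indices are integers because \<open>i + j + l\<close> may be negative; the
  constants vanish as soon as one index is not positive, in accordance with \<open>e\<^sub>k = 0\<close> for
  \<open>k \<le> 0\<close>.\<close>

definition sc :: "int \<Rightarrow> int \<Rightarrow> 'k::field" where
  "sc i j = (if i = 1 \<and> j \<ge> 2 \<or> i = 2 \<and> j \<ge> 3 then 1
     else if j = 1 \<and> i \<ge> 2 \<or> j = 2 \<and> i \<ge> 3 then -1 else 0)"

lemma sc_swap: "sc j i = (- sc i j :: 'k::field)"
  by (auto simp: sc_def)

lemma m2_bracket_e_sc: "m2_bracket (m2_e i) (m2_e j) = m2_scale (sc i j) (m2_e (i + j))"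
proof -
  consider "i \<le> 0" | "j \<le> 0" | "1 \<le> i" "1 \<le> j" by linarith
  then show ?thesis
  proof cases
    case 1
    then show ?thesis by (simp add: m2_e_def m2_bracket_def sc_def)
  next
    case 2
    then show ?thesis by (simp add: m2_e_def m2_bracket_def sc_def)
  next
    case 3
    then show ?thesis
      by (auto simp: m2_bracket_e m2_basis_bracket_def sc_def nat_eq_iff le_nat_iff add.commute)
  qed
qed

text \<open>The coordinate of \<open>x\<close> at \<open>e\<^sub>k\<close>, with the value \<open>0\<close> if there is no such basis vector. This
  default makes the coefficient arrays below unique.\<close>

definition m2_coord :: "int \<Rightarrow> 'k::field m2 \<Rightarrow> 'k" where
  "m2_coord k x = (if k \<le> 0 then 0 else Poly_Mapping.lookup x (nat k - 1))"

lemma m2_coord_simps [simp]: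
  "m2_coord k (x + y) = m2_coord k x + m2_coord k y"
  "m2_coord k (m2_scale c x) = c * m2_coord k x"
  "m2_coord k 0 = 0"
  by (auto simp: m2_coord_def lookup_add)

lemma m2_coord_e: "m2_coord k (m2_e k) = (if k \<le> 0 then 0 else 1)"
  by (simp add: m2_coord_def m2_e_def)

lemma m2_coord_low: "k \<le> 0 \<Longrightarrow> m2_coord k x = 0"
  by (simp add: m2_coord_def)

lemma m2_scale_coord:
  assumes "\<exists>c. x = m2_scale c (m2_e k)"
  shows "x = m2_scale (m2_coord k x) (m2_e k)"
  using assms by (auto simp: m2_coord_e m2_e_eq_0_iff)

section \<open>Coefficient arrays of homogeneous cochains\<close>

definition coeff1 :: "int \<Rightarrow> ('k::field m2 \<Rightarrow> 'k m2) \<Rightarrow> int \<Rightarrow> 'k" where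
  "coeff1 l \<phi> i = m2_coord (i + l) (\<phi> (m2_e i))"

definition coeff2 :: "int \<Rightarrow> ('k::field m2 \<Rightarrow> 'k m2 \<Rightarrow> 'k m2) \<Rightarrow> int \<Rightarrow> int \<Rightarrow> 'k" where
  "coeff2 l \<omega> i j = m2_coord (i + j + l) (\<omega> (m2_e i) (m2_e j))"

lemma coeff1_e:
  "m2_weight1 l \<phi> \<Longrightarrow> 1 \<le> i \<Longrightarrow> \<phi> (m2_e i) = m2_scale (coeff1 l \<phi> i) (m2_e (i + l))"
  unfolding coeff1_def by (rule m2_scale_coord) (simp add: m2_weight1_def)

lemma coeff2_e:
  "m2_weight2 l \<omega> \<Longrightarrow> 1 \<le> i \<Longrightarrow> 1 \<le> j \<Longrightarrow>
    \<omega> (m2_e i) (m2_e j) = m2_scale (coeff2 l \<omega> i j) (m2_e (i + j + l))"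
  unfolding coeff2_def by (rule m2_scale_coord) (simp add: m2_weight2_def)

text \<open>The coefficient of \<open>e\<^bsub>i+j+k+l\<^esub>\<close> in \<open>d\<omega> (e\<^sub>i, e\<^sub>j, e\<^sub>k)\<close> (see \<open>m2_d2_e\<close>).\<close>

definition cocycle_eq :: "int \<Rightarrow> (int \<Rightarrow> int \<Rightarrow> 'k::field) \<Rightarrow> int \<Rightarrow> int \<Rightarrow> int \<Rightarrow> 'k" where
  "cocycle_eq l A i j k =
     sc i (j + k + l) * A j k - sc j (i + k + l) * A i k + sc k (i + j + l) * A i j
     - sc i j * A (i + j) k + sc i k * A (i + k) j - sc j k * A (j + k) i"

definition cocycle_coeff :: "int \<Rightarrow> (int \<Rightarrow> int \<Rightarrow> 'k::field) \<Rightarrow> bool" where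
  "cocycle_coeff l A \<longleftrightarrow> (\<forall>i\<ge>1. \<forall>j\<ge>1. A j i = - A i j) \<and>
     (\<forall>i\<ge>1. \<forall>j\<ge>1. i + j + l \<le> 0 \<longrightarrow> A i j = 0) \<and>
     (\<forall>i\<ge>1. \<forall>j\<ge>1. \<forall>k\<ge>1. cocycle_eq l A i j k = 0)"

text \<open>The coefficient array of \<open>d\<phi>\<close> for \<open>\<phi> (e\<^sub>i) = b i \<cdot> e\<^bsub>i+l\<^esub>\<close> (see \<open>coeff2_d1\<close>).\<close>

definition coboundary_coeff :: "int \<Rightarrow> (int \<Rightarrow> 'k::field) \<Rightarrow> int \<Rightarrow> int \<Rightarrow> 'k" where
  "coboundary_coeff l b i j = sc i (j + l) * b j - sc j (i + l) * b i - sc i j * b (i + j)"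

definition is_coboundary_coeff :: "int \<Rightarrow> (int \<Rightarrow> int \<Rightarrow> 'k::field) \<Rightarrow> bool" where
  "is_coboundary_coeff l A \<longleftrightarrow> (\<exists>b. (\<forall>i\<ge>1. i + l \<le> 0 \<longrightarrow> b i = 0) \<and>
     (\<forall>i\<ge>1. \<forall>j\<ge>1. A i j = coboundary_coeff l b i j))"

lemma cocycle_coeff_antisym:
  "cocycle_coeff l A \<Longrightarrow> 1 \<le> i \<Longrightarrow> 1 \<le> j \<Longrightarrow> A j i = - A i j"
  unfolding cocycle_coeff_def by blast

lemma cocycle_coeff_low:
  "cocycle_coeff l A \<Longrightarrow> 1 \<le> i \<Longrightarrow> 1 \<le> j \<Longrightarrow> i + j + l \<le> 0 \<Longrightarrow> A i j = 0"
  unfolding cocycle_coeff_def by blast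

lemma cocycle_coeff_self:
  fixes A :: "int \<Rightarrow> int \<Rightarrow> 'k::field_char_0"
  shows "cocycle_coeff l A \<Longrightarrow> 1 \<le> i \<Longrightarrow> A i i = 0"
  using cocycle_coeff_antisym[of l A i i] by (simp add: eq_neg_iff_add_eq_0 flip: mult_2)

lemma cocycle_coeff_eq:
  "cocycle_coeff l A \<Longrightarrow> 1 \<le> i \<Longrightarrow> 1 \<le> j \<Longrightarrow> 1 \<le> k \<Longrightarrow> cocycle_eq l A i j k = 0"
  unfolding cocycle_coeff_def by blast

text \<open>The cocycle expression is alternating in its three indices, so increasing triples suffice.\<close>

lemma cocycle_coeffI:
  fixes A :: "int \<Rightarrow> int \<Rightarrow> 'k::field_char_0"
  assumes anti: "\<And>i j. 1 \<le> i \<Longrightarrow> 1 \<le> j \<Longrightarrow> A j i = - A i j"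
    and low: "\<And>i j. 1 \<le> i \<Longrightarrow> 1 \<le> j \<Longrightarrow> i + j + l \<le> 0 \<Longrightarrow> A i j = 0"
    and eq: "\<And>i j k. 1 \<le> i \<Longrightarrow> i < j \<Longrightarrow> j < k \<Longrightarrow> cocycle_eq l A i j k = 0"
  shows "cocycle_coeff l A"
proof -
  have swap12: "cocycle_eq l A j i k = - cocycle_eq l A i j k"
    if "1 \<le> i" "1 \<le> j" "1 \<le> k" for i j k
    using that anti[of i j] sc_swap[of j i, where ?'k = 'k]
    by (simp add: cocycle_eq_def algebra_simps)
  have swap23: "cocycle_eq l A i k j = - cocycle_eq l A i j k"
    if "1 \<le> i" "1 \<le> j" "1 \<le> k" for i j k
    using that anti[of j k] sc_swap[of k j, where ?'k = 'k]
    by (simp add: cocycle_eq_def algebra_simps)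
  have "cocycle_eq l A i j k = 0" if "1 \<le> i" "1 \<le> j" "1 \<le> k" for i j k
  proof -
    have same: "cocycle_eq l A p p q = 0" "cocycle_eq l A p q q = 0"
      if "1 \<le> p" "1 \<le> q" for p q
      using swap12[of p p q] swap23[of p q q] that
      by (simp_all add: eq_neg_iff_add_eq_0 flip: mult_2)
    have lt: "cocycle_eq l A p q r = 0" if "1 \<le> p" "1 \<le> q" "1 \<le> r" "p < q" for p q r
    proof -
      consider "r < p" | "r = p" | "p < r" "r < q" | "r = q" | "q < r" using \<open>p < q\<close> by linarith
      then show ?thesis
      proof cases
        case 1
        then show ?thesis using eq[of r p q] swap12[of p r q] swap23[of p q r] that by simp
      next
        case 2
        then show ?thesis using swap23[of p p q] same[of p q] that by simp
      next
        case 3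
        then show ?thesis using eq[of p r q] swap23[of p r q] that by simp
      next
        case 4
        then show ?thesis using same that by simp
      next
        case 5
        then show ?thesis using eq that by simp
      qed
    qed
    consider "i < j" | "i = j" | "j < i" by linarith
    then show ?thesis
      using lt[of i j k] lt[of j i k] swap12[of j i k] same[of i k] that by cases auto
  qed
  then show ?thesis using anti low unfolding cocycle_coeff_def by blast
qed

lemma m2_cochain2_simps:
  assumes "m2_cochain2 \<omega>"
  shows "\<omega> (x + y) z = \<omega> x z + \<omega> y z" "\<omega> (x - y) z = \<omega> x z - \<omega> y z"
    "\<omega> (- x) z = - \<omega> x z" "\<omega> 0 z = 0" "\<omega> (m2_scale c x) z = m2_scale c (\<omega> x z)"
    "\<omega> x (y + z) = \<omega> x y + \<omega> x z" "\<omega> x (y - z) = \<omega> x y - \<omega> x z"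
    "\<omega> x (- z) = - \<omega> x z" "\<omega> x 0 = 0" "\<omega> x (m2_scale c z) = m2_scale c (\<omega> x z)"
    "\<omega> x x = 0"
proof -
  have l: "Vector_Spaces.linear m2_scale m2_scale (\<omega> x)"
    "Vector_Spaces.linear m2_scale m2_scale (\<lambda>x. \<omega> x y)" "\<omega> x x = 0" for x y
    using assms unfolding m2_cochain2_def by blast+
  show "\<omega> (x + y) z = \<omega> x z + \<omega> y z" "\<omega> (x - y) z = \<omega> x z - \<omega> y z"
    "\<omega> (- x) z = - \<omega> x z" "\<omega> 0 z = 0" "\<omega> (m2_scale c x) z = m2_scale c (\<omega> x z)"
    by (rule m2_linear_simps[OF l(2)])+
  show "\<omega> x (y + z) = \<omega> x y + \<omega> x z" "\<omega> x (y - z) = \<omega> x y - \<omega> x z"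
    "\<omega> x (- z) = - \<omega> x z" "\<omega> x 0 = 0" "\<omega> x (m2_scale c z) = m2_scale c (\<omega> x z)"
    by (rule m2_linear_simps[OF l(1)])+
  show "\<omega> x x = 0" by (rule l(3))
qed

lemma m2_cochain2_antisym:
  assumes "m2_cochain2 \<omega>"
  shows "\<omega> y x = - \<omega> x y"
proof -
  have "\<omega> (x + y) (x + y) = \<omega> x y + \<omega> y x"
    by (simp only: m2_cochain2_simps(1,6)[OF assms]) (simp add: m2_cochain2_simps(11)[OF assms])
  then have "\<omega> x y + \<omega> y x = 0" by (simp add: m2_cochain2_simps(11)[OF assms])
  then show ?thesis by (simp add: eq_neg_iff_add_eq_0 add.commute)
qed

lemma m2_d2_e:
  assumes \<omega>: "m2_cochain2 \<omega>" "m2_weight2 l \<omega>" and ijk: "1 \<le> i" "1 \<le> j" "1 \<le> k"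
  shows "m2_d2 \<omega> (m2_e i) (m2_e j) (m2_e k)
    = m2_scale (cocycle_eq l (coeff2 l \<omega>) i j k) (m2_e (i + j + k + l))"
proof -
  note e = coeff2_e[OF \<omega>(2)]
  have 1: "m2_bracket (m2_e p) (\<omega> (m2_e q) (m2_e r))
      = m2_scale (sc p (q + r + l) * coeff2 l \<omega> q r) (m2_e (p + q + r + l))"
    if "1 \<le> p" "1 \<le> q" "1 \<le> r" for p q r
    using that by (simp add: e m2_bracket_scale_right m2_bracket_e_sc mult.commute add.assoc)
  have 2: "\<omega> (m2_bracket (m2_e p) (m2_e q)) (m2_e r)
      = m2_scale (sc p q * coeff2 l \<omega> (p + q) r) (m2_e (p + q + r + l))"
    if "1 \<le> p" "1 \<le> q" "1 \<le> r" for p q r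
    using that by (simp add: m2_bracket_e_sc m2_cochain2_simps[OF \<omega>(1)] e add.assoc)
  have perm: "j + i + k = i + j + k" "k + i + j = i + j + k" "i + k + j = i + j + k"
    "j + k + i = i + j + k" by simp_all
  show ?thesis
    using ijk unfolding m2_d2_def cocycle_eq_def
    by (simp add: 1 2 perm m2.scale_left_distrib m2.scale_left_diff_distrib)
qed

lemma coeff2_antisym:
  assumes "m2_cochain2 \<omega>"
  shows "coeff2 l \<omega> j i = - coeff2 l \<omega> i j"
proof -
  have "\<omega> (m2_e j) (m2_e i) = m2_scale (-1) (\<omega> (m2_e i) (m2_e j))"
    by (subst m2_cochain2_antisym[OF assms]) simp
  then show ?thesis unfolding coeff2_def
    by (simp only: m2_coord_simps add.commute[of j i] mult_minus1)
qed

lemma coeff2_low: "i + j + l \<le> 0 \<Longrightarrow> coeff2 l \<omega> i j = 0"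
  by (simp add: coeff2_def m2_coord_low)

lemma cocycle_eq_low:
  assumes "\<And>i j. 1 \<le> i \<Longrightarrow> 1 \<le> j \<Longrightarrow> i + j + l \<le> 0 \<Longrightarrow> A i j = 0"
    and "1 \<le> i" "1 \<le> j" "1 \<le> k" "i + j + k + l \<le> 0"
  shows "cocycle_eq l A i j k = 0"
  using assms(2-) by (simp add: cocycle_eq_def assms(1))

lemma cocycle_coeff2:
  assumes \<omega>: "m2_cochain2 \<omega>" "m2_weight2 l \<omega>" and z: "\<And>x y z. m2_d2 \<omega> x y z = 0"
  shows "cocycle_coeff l (coeff2 l \<omega>)"
proof -
  have "cocycle_eq l (coeff2 l \<omega>) i j k = 0" if "1 \<le> i" "1 \<le> j" "1 \<le> k" for i j k
  proof (cases "i + j + k + l \<le> 0")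
    case True
    then show ?thesis using that by (intro cocycle_eq_low coeff2_low)
  next
    case False
    then show ?thesis
      using m2_d2_e[OF \<omega> that] by (simp add: z m2_e_eq_0_iff)
  qed
  then show ?thesis
    unfolding cocycle_coeff_def using coeff2_antisym[OF \<omega>(1)] coeff2_low by blast
qed

lemma coeff2_cocycle:
  fixes \<omega> :: "'k::field_char_0 m2 \<Rightarrow> 'k m2 \<Rightarrow> 'k m2"
  assumes "\<omega> \<in> carrier (m2_cocycles l)"
  shows "cocycle_coeff l (coeff2 l \<omega>)"
  using assms by (intro cocycle_coeff2) (auto simp: m2_cocycles_def)

lemma m2_d2_linear:
  assumes "m2_cochain2 \<omega>"
  shows "Vector_Spaces.linear m2_scale m2_scale (\<lambda>x. m2_d2 \<omega> x y z)"
    and "Vector_Spaces.linear m2_scale m2_scale (\<lambda>y. m2_d2 \<omega> x y z)"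
    and "Vector_Spaces.linear m2_scale m2_scale (\<lambda>z. m2_d2 \<omega> x y z)"
  by (intro m2_linearI;
      simp add: m2_d2_def m2_cochain2_simps[OF assms] m2_bracket_simps m2.scale_right_distrib
        m2.scale_right_diff_distrib)+

lemma m2_d2_eq_0I:
  assumes "m2_cochain2 \<omega>"
    and "\<And>i j k. 1 \<le> i \<Longrightarrow> 1 \<le> j \<Longrightarrow> 1 \<le> k \<Longrightarrow> m2_d2 \<omega> (m2_e i) (m2_e j) (m2_e k) = 0"
  shows "m2_d2 \<omega> x y z = 0"
  by (rule m2_linear_eq_0[OF m2_d2_linear(1)[OF assms(1)]],
      rule m2_linear_eq_0[OF m2_d2_linear(2)[OF assms(1)]],
      rule m2_linear_eq_0[OF m2_d2_linear(3)[OF assms(1)]]) (rule assms(2))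

definition cochain2_of :: "int \<Rightarrow> (int \<Rightarrow> int \<Rightarrow> 'k::field) \<Rightarrow> 'k m2 \<Rightarrow> 'k m2 \<Rightarrow> 'k m2" where
  "cochain2_of l A x y = m2_extend (\<lambda>i. m2_extend (\<lambda>j. m2_scale (A i j) (m2_e (i + j + l))) y) x"

lemma cochain2_of_e:
  "1 \<le> i \<Longrightarrow> 1 \<le> j \<Longrightarrow> cochain2_of l A (m2_e i) (m2_e j) = m2_scale (A i j) (m2_e (i + j + l))"
  by (simp add: cochain2_of_def m2_extend_e)

lemma linear_cochain2_of:
  "Vector_Spaces.linear m2_scale m2_scale (cochain2_of l A x)"
  "Vector_Spaces.linear m2_scale m2_scale (\<lambda>x. cochain2_of l A x y)"
proof -
  show "Vector_Spaces.linear m2_scale m2_scale (cochain2_of l A x)"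
    by (rule m2_linearI) (simp_all add: cochain2_of_def m2_linear_simps[OF linear_m2_extend]
      m2_extend_def[of _ x] m2.scale_right_distrib sum.distrib m2.scale_sum_right mult.commute)
  show "Vector_Spaces.linear m2_scale m2_scale (\<lambda>x. cochain2_of l A x y)"
    unfolding cochain2_of_def by (rule linear_m2_extend)
qed

lemma cochain2_cochain2_of:
  fixes A :: "int \<Rightarrow> int \<Rightarrow> 'k::field_char_0"
  assumes anti: "\<And>i j. 1 \<le> i \<Longrightarrow> 1 \<le> j \<Longrightarrow> A j i = - A i j"
  shows "m2_cochain2 (cochain2_of l A)"
proof -
  let ?w = "cochain2_of l A"
  note simps = m2_linear_simps[OF linear_cochain2_of(1)] m2_linear_simps[OF linear_cochain2_of(2)]
  have "?w x y + ?w y x = 0" for x y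
  proof (rule m2_bilinear_eq_0[of "\<lambda>x y. ?w x y + ?w y x"])
    fix i j :: int assume ij: "1 \<le> i" "1 \<le> j"
    then show "?w (m2_e i) (m2_e j) + ?w (m2_e j) (m2_e i) = 0"
      using anti[OF ij] by (simp add: cochain2_of_e add.commute)
  qed (rule m2_linearI; simp add: simps m2.scale_right_distrib)+
  from this[of x x for x] have "m2_scale 2 (?w x x) = 0" for x
    using m2.scale_left_distrib[of 1 1 "?w x x"] by simp
  then show ?thesis
    using linear_cochain2_of[of l A] by (simp add: m2_cochain2_def)
qed

lemma coeff2_cochain2_of:
  assumes "1 \<le> i" "1 \<le> j" "i + j + l \<le> 0 \<longrightarrow> A i j = 0"
  shows "coeff2 l (cochain2_of l A) i j = A i j"
  using assms by (simp add: coeff2_def cochain2_of_e m2_coord_e)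

text \<open>Together with \<open>coeff2_cocycle\<close> and \<open>cochain2_eqI\<close>: homogeneous cocycles and the arrays that
  satisfy \<open>cocycle_coeff\<close> are the same thing, up to entries with an index below \<open>1\<close>.\<close>

lemma cocycle_cochain2_of:
  fixes A :: "int \<Rightarrow> int \<Rightarrow> 'k::field_char_0"
  assumes A: "cocycle_coeff l A"
  shows "cochain2_of l A \<in> carrier (m2_cocycles l)"
    and "\<And>i j. 1 \<le> i \<Longrightarrow> 1 \<le> j \<Longrightarrow> coeff2 l (cochain2_of l A) i j = A i j"
proof -
  let ?w = "cochain2_of l A"
  have coeff: "coeff2 l ?w i j = A i j" if "1 \<le> i" "1 \<le> j" for i j
    using that cocycle_coeff_low[OF A] by (intro coeff2_cochain2_of) auto
  then show "\<And>i j. 1 \<le> i \<Longrightarrow> 1 \<le> j \<Longrightarrow> coeff2 l ?w i j = A i j" .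
  have w: "m2_cochain2 ?w" using cocycle_coeff_antisym[OF A] by (rule cochain2_cochain2_of)
  have wt: "m2_weight2 l ?w" by (auto simp: m2_weight2_def cochain2_of_e)
  have "cocycle_eq l (coeff2 l ?w) i j k = cocycle_eq l A i j k"
    if "1 \<le> i" "1 \<le> j" "1 \<le> k" for i j k
    using that by (simp add: cocycle_eq_def coeff)
  then have "m2_d2 ?w (m2_e i) (m2_e j) (m2_e k) = 0" if "1 \<le> i" "1 \<le> j" "1 \<le> k" for i j k
    using that cocycle_coeff_eq[OF A] by (simp add: m2_d2_e[OF w wt])
  then show "?w \<in> carrier (m2_cocycles l)"
    using w wt m2_d2_eq_0I[OF w] by (simp add: m2_cocycles_def)
qed

lemma cochain2_eqI:
  assumes "m2_cochain2 \<omega>" "m2_weight2 l \<omega>" "m2_cochain2 \<eta>" "m2_weight2 l \<eta>"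
    and "\<And>i j. 1 \<le> i \<Longrightarrow> 1 \<le> j \<Longrightarrow> coeff2 l \<omega> i j = coeff2 l \<eta> i j"
  shows "\<omega> = \<eta>"
proof (intro ext)
  fix x y
  have "\<omega> x y - \<eta> x y = 0"
  proof (rule m2_bilinear_eq_0[of "\<lambda>x y. \<omega> x y - \<eta> x y"])
    fix i j :: int assume "1 \<le> i" "1 \<le> j"
    then show "\<omega> (m2_e i) (m2_e j) - \<eta> (m2_e i) (m2_e j) = 0"
      using assms by (simp add: coeff2_e)
  qed (rule m2_linearI; simp add: m2_cochain2_simps[OF assms(1)] m2_cochain2_simps[OF assms(3)]
      m2.scale_right_diff_distrib)+
  then show "\<omega> x y = \<eta> x y" by simp
qed

lemma m2_d1_cochain2:
  fixes \<phi> :: "'k::field_char_0 m2 \<Rightarrow> 'k m2"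
  assumes "m2_cochain1 \<phi>"
  shows "m2_cochain2 (m2_d1 \<phi>)"
proof -
  note \<phi> = m2_linear_simps[OF assms[unfolded m2_cochain1_def]]
  show ?thesis
    unfolding m2_cochain2_def
    by (intro conjI allI m2_linearI; simp add: m2_d1_def \<phi> m2_bracket_simps m2_bracket_self
        m2.scale_right_distrib m2.scale_right_diff_distrib)
qed

text \<open>After expanding, the nine double brackets cancel in threes by the Jacobi identity in Leibniz
  form, once for each of \<open>\<phi> x\<close>, \<open>\<phi> y\<close>, \<open>\<phi> z\<close>; the terms inside \<open>\<phi>\<close> cancel by the Jacobi identity of
  \<open>x\<close>, \<open>y\<close>, \<open>z\<close>.\<close>

lemma m2_d2_d1:
  fixes \<phi> :: "'k::field_char_0 m2 \<Rightarrow> 'k m2"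
  assumes "m2_cochain1 \<phi>"
  shows "m2_d2 (m2_d1 \<phi>) x y z = 0"
proof -
  note \<phi> = m2_linear_simps[OF assms[unfolded m2_cochain1_def]]
  have J: "m2_bracket x (m2_bracket y z)
      = m2_bracket (m2_bracket x y) z + m2_bracket y (m2_bracket x z)"
    for x y z :: "'k m2"
  proof -
    have "m2_bracket y (m2_bracket z x) = - m2_bracket y (m2_bracket x z)"
      by (subst m2_bracket_antisym[of z x]) (rule m2_bracket_neg_right)
    moreover have "m2_bracket z (m2_bracket x y) = - m2_bracket (m2_bracket x y) z"
      by (rule m2_bracket_antisym)
    ultimately show ?thesis using m2_jacobi[of x y z] by (simp add: algebra_simps)
  qed
  show ?thesis
    unfolding m2_d2_def m2_d1_def
    by (simp add: \<phi> m2_bracket_diff_right m2_bracket_add_right)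
      (simp add: J[of x y "\<phi> z"] J[of x z "\<phi> y"] J[of y z "\<phi> x"] J[of x y z]
        m2_bracket_antisym[of "m2_bracket y z" x]
        m2_bracket_antisym[of "m2_bracket x z" y] \<phi>)
qed

lemma coeff2_d1:
  assumes \<phi>: "m2_cochain1 \<phi>" "m2_weight1 l \<phi>" and ij: "1 \<le> i" "1 \<le> j"
  shows "m2_d1 \<phi> (m2_e i) (m2_e j)
      = m2_scale (coboundary_coeff l (coeff1 l \<phi>) i j) (m2_e (i + j + l))"
    and "coeff2 l (m2_d1 \<phi>) i j = coboundary_coeff l (coeff1 l \<phi>) i j"
proof -
  have perm: "j + (i + l) = i + j + l" "i + (j + l) = i + j + l" by simp_all
  note lin = m2_linear_simps[OF \<phi>(1)[unfolded m2_cochain1_def]]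
  show 1: "m2_d1 \<phi> (m2_e i) (m2_e j)
      = m2_scale (coboundary_coeff l (coeff1 l \<phi>) i j) (m2_e (i + j + l))"
    using ij
    by (simp add: m2_d1_def coboundary_coeff_def coeff1_e[OF \<phi>(2)] m2_bracket_e_sc lin
        m2_bracket_scale_right perm m2.scale_left_diff_distrib mult.commute)
  have "coboundary_coeff l (coeff1 l \<phi>) i j = 0" if "i + j + l \<le> 0"
    using ij that by (simp add: coboundary_coeff_def coeff1_def m2_coord_low)
  then show "coeff2 l (m2_d1 \<phi>) i j = coboundary_coeff l (coeff1 l \<phi>) i j"
    unfolding coeff2_def 1 by (simp add: m2_coord_e)
qed

lemma m2_coboundaries_subset:
  "m2_coboundaries l \<subseteq> carrier (m2_cocycles l :: ('k::field_char_0, _) module)"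
proof
  fix \<omega> :: "'k m2 \<Rightarrow> 'k m2 \<Rightarrow> 'k m2" assume "\<omega> \<in> m2_coboundaries l"
  then obtain \<phi> where \<phi>: "m2_cochain1 \<phi>" "m2_weight1 l \<phi>" and \<omega>: "\<omega> = m2_d1 \<phi>"
    by (auto simp: m2_coboundaries_def)
  have "m2_weight2 l \<omega>"
    unfolding m2_weight2_def \<omega> using coeff2_d1(1)[OF \<phi>] by blast
  then show "\<omega> \<in> carrier (m2_cocycles l)"
    using m2_d1_cochain2[OF \<phi>(1)] m2_d2_d1[OF \<phi>(1)] by (simp add: m2_cocycles_def \<omega>)
qed

lemma cochain1_exists:
  assumes "\<And>i. 1 \<le> i \<Longrightarrow> i + l \<le> 0 \<Longrightarrow> b i = 0"
  obtains \<phi> where "m2_cochain1 \<phi>" "m2_weight1 l \<phi>" "\<And>i. 1 \<le> i \<Longrightarrow> coeff1 l \<phi> i = b i"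
proof (rule that)
  let ?f = "m2_extend (\<lambda>i. m2_scale (b i) (m2_e (i + l)))"
  show "m2_cochain1 ?f" by (simp add: m2_cochain1_def linear_m2_extend)
  show "m2_weight1 l ?f" by (auto simp: m2_weight1_def m2_extend_e)
  show "coeff1 l ?f i = b i" if "1 \<le> i" for i
    using that assms[of i] by (simp add: coeff1_def m2_extend_e m2_coord_e)
qed

lemma coboundary_coeff_cong:
  assumes "\<And>i. 1 \<le> i \<Longrightarrow> b i = b' i" "1 \<le> i" "1 \<le> j"
  shows "coboundary_coeff l b i j = coboundary_coeff l b' i j"
  using assms by (simp add: coboundary_coeff_def)

lemma m2_coboundaries_iff:
  fixes \<omega> :: "'k::field_char_0 m2 \<Rightarrow> 'k m2 \<Rightarrow> 'k m2"
  assumes \<omega>: "\<omega> \<in> carrier (m2_cocycles l)"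
  shows "\<omega> \<in> m2_coboundaries l \<longleftrightarrow> is_coboundary_coeff l (coeff2 l \<omega>)"
    (is "_ \<longleftrightarrow> ?R")
proof
  assume "\<omega> \<in> m2_coboundaries l"
  then obtain \<phi> where \<phi>: "m2_cochain1 \<phi>" "m2_weight1 l \<phi>" and "\<omega> = m2_d1 \<phi>"
    by (auto simp: m2_coboundaries_def)
  then show ?R
    using coeff2_d1(2)[OF \<phi>] unfolding is_coboundary_coeff_def
    by (intro exI[of _ "coeff1 l \<phi>"]) (simp add: coeff1_def m2_coord_low)
next
  assume ?R
  then obtain b where b: "\<And>i. 1 \<le> i \<Longrightarrow> i + l \<le> 0 \<Longrightarrow> b i = 0"
    and eq: "\<And>i j. 1 \<le> i \<Longrightarrow> 1 \<le> j \<Longrightarrow> coeff2 l \<omega> i j = coboundary_coeff l b i j"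
    unfolding is_coboundary_coeff_def by blast
  obtain \<phi> where \<phi>: "m2_cochain1 \<phi>" "m2_weight1 l \<phi>" "\<And>i. 1 \<le> i \<Longrightarrow> coeff1 l \<phi> i = b i"
    using cochain1_exists[of l b] b by blast
  have mem: "m2_d1 \<phi> \<in> m2_coboundaries l" using \<phi> by (auto simp: m2_coboundaries_def)
  have "\<omega> = m2_d1 \<phi>"
  proof (rule cochain2_eqI[of _ l])
    fix i j :: int assume "1 \<le> i" "1 \<le> j"
    then show "coeff2 l \<omega> i j = coeff2 l (m2_d1 \<phi>) i j"
      using coeff2_d1(2)[OF \<phi>(1,2)] coboundary_coeff_cong[OF \<phi>(3)] eq by simp
  qed (use \<omega> mem m2_coboundaries_subset[of l] in \<open>auto simp: m2_cocycles_def\<close>)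
  then show "\<omega> \<in> m2_coboundaries l" using mem by simp
qed

text \<open>The identity \<open>d \<circ> d = 0\<close> for arrays, obtained from the one for cochains.\<close>

lemma cocycle_coboundary_coeff:
  fixes b :: "int \<Rightarrow> 'k::field_char_0"
  assumes b: "\<And>i. 1 \<le> i \<Longrightarrow> i + l \<le> 0 \<Longrightarrow> b i = 0"
  shows "cocycle_coeff l (coboundary_coeff l b)"
proof -
  obtain \<phi> where \<phi>: "m2_cochain1 \<phi>" "m2_weight1 l \<phi>" "\<And>i. 1 \<le> i \<Longrightarrow> coeff1 l \<phi> i = b i"
    using cochain1_exists[of l b] b by blast
  have "m2_d1 \<phi> \<in> carrier (m2_cocycles l)"
    using \<phi> m2_coboundaries_subset[of l] by (auto simp: m2_coboundaries_def)
  then have *: "cocycle_coeff l (coeff2 l (m2_d1 \<phi>))"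
    by (intro cocycle_coeff2) (auto simp: m2_cocycles_def)
  have eq: "coeff2 l (m2_d1 \<phi>) i j = coboundary_coeff l b i j" if "1 \<le> i" "1 \<le> j" for i j
    using that coeff2_d1(2)[OF \<phi>(1,2)] coboundary_coeff_cong[OF \<phi>(3)] by simp
  have "cocycle_eq l (coboundary_coeff l b) i j k = cocycle_eq l (coeff2 l (m2_d1 \<phi>)) i j k"
    if "1 \<le> i" "1 \<le> j" "1 \<le> k" for i j k
    using that by (simp add: cocycle_eq_def eq)
  then show ?thesis
    using * eq unfolding cocycle_coeff_def by metis
qed

lemma coboundary_coeff_diff:
  "coboundary_coeff l (\<lambda>i. b i - b' i) i j = coboundary_coeff l b i j - coboundary_coeff l b' i j"
  by (simp add: coboundary_coeff_def algebra_simps)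

lemma coboundary_coeff_add:
  "coboundary_coeff l (\<lambda>i. b i + b' i) i j = coboundary_coeff l b i j + coboundary_coeff l b' i j"
  by (simp add: coboundary_coeff_def algebra_simps)

lemma cocycle_coeff_diff:
  assumes "cocycle_coeff l A" "cocycle_coeff l B"
  shows "cocycle_coeff l (\<lambda>i j. A i j - B i j)"
proof -
  have "A j i - B j i = - (A i j - B i j)" if "1 \<le> i" "1 \<le> j" for i j
    using cocycle_coeff_antisym[OF assms(1) that] cocycle_coeff_antisym[OF assms(2) that] by simp
  moreover have "A i j - B i j = 0" if "1 \<le> i" "1 \<le> j" "i + j + l \<le> 0" for i j
    using cocycle_coeff_low[OF assms(1) that] cocycle_coeff_low[OF assms(2) that] by simp
  moreover have "cocycle_eq l (\<lambda>i j. A i j - B i j) i j k = 0" if "1 \<le> i" "1 \<le> j" "1 \<le> k"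
    for i j k
  proof -
    have "cocycle_eq l (\<lambda>i j. A i j - B i j) i j k = cocycle_eq l A i j k - cocycle_eq l B i j k"
      by (simp add: cocycle_eq_def algebra_simps)
    then show ?thesis
      using cocycle_coeff_eq[OF assms(1) that] cocycle_coeff_eq[OF assms(2) that] by simp
  qed
  ultimately show ?thesis unfolding cocycle_coeff_def by blast
qed

section \<open>Normalisation along \<open>e\<^sub>1\<close>\<close>

fun normalizer_seq :: "int \<Rightarrow> (int \<Rightarrow> int \<Rightarrow> 'k::field) \<Rightarrow> nat \<Rightarrow> 'k" where
  "normalizer_seq l A 0 = 0"
| "normalizer_seq l A (Suc n) = sc 1 (int n + 2 + l) * normalizer_seq l A n - A 1 (int n + 2)"

text \<open>The \<open>1\<close>-cochain whose coboundary has the same entries \<open>1 i\<close> as \<open>A\<close>. It depends linearly on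
  \<open>A\<close>, so that entries of the normalised array are linear functionals of the cocycle. The sequence
  \<open>normalizer_seq\<close> starts at the index \<open>2\<close>.\<close>

definition normalizer :: "int \<Rightarrow> (int \<Rightarrow> int \<Rightarrow> 'k::field) \<Rightarrow> int \<Rightarrow> 'k" where
  "normalizer l A i = (if i \<le> 2 then 0 else normalizer_seq l A (nat (i - 2)))"

lemma normalizer_step:
  assumes "2 \<le> i"
  shows "normalizer l A (i + 1) = sc 1 (i + l) * normalizer l A i - A 1 i"
proof -
  have "nat (i + 1 - 2) = Suc (nat (i - 2))" using assms by simp
  then show ?thesis using assms by (cases "i = 2") (auto simp: normalizer_def simp flip: of_nat_nat)
qed

lemma normalizer_induct [consumes 1, case_names base step]:
  assumes "(1::int) \<le> i" "\<And>i. 1 \<le> i \<Longrightarrow> i \<le> 2 \<Longrightarrow> P i" "\<And>i. 2 \<le> i \<Longrightarrow> P i \<Longrightarrow> P (i + 1)"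
  shows "P i"
proof (cases "i \<le> 2")
  case False
  then have "2 \<le> i" by simp
  then show ?thesis by (induction i rule: int_ge_induct) (use assms in auto)
qed (use assms in auto)

lemma normalizer_normalizes:
  fixes A :: "int \<Rightarrow> int \<Rightarrow> 'k::field_char_0"
  assumes A: "cocycle_coeff l A" and "1 \<le> i"
  shows "coboundary_coeff l (normalizer l A) 1 i = A 1 i"
proof (cases "i = 1")
  case True
  then show ?thesis
    using cocycle_coeff_self[OF A, of 1] by (simp add: coboundary_coeff_def normalizer_def sc_def)
next
  case False
  then have "2 \<le> i" using assms by simp
  have "normalizer l A 1 = 0" by (simp add: normalizer_def)
  moreover have "sc 1 i = (1::'k)" using \<open>2 \<le> i\<close> by (simp add: sc_def)
  ultimately show ?thesis
    using normalizer_step[OF \<open>2 \<le> i\<close>, of l A] by (simp add: coboundary_coeff_def add.commute)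
qed

lemma normalizer_low:
  assumes A: "cocycle_coeff l A" and "1 \<le> i" "i + l \<le> 0"
  shows "normalizer l A i = 0"
  using assms(2,3)
proof (induction i rule: normalizer_induct)
  case (base i)
  then show ?case by (simp add: normalizer_def)
next
  case (step i)
  then show ?case using cocycle_coeff_low[OF A, of 1 i] by (simp add: normalizer_step)
qed

lemma normalizer_add:
  assumes "1 \<le> i"
  shows "normalizer l (\<lambda>i j. A i j + B i j) i = normalizer l A i + normalizer l B i"
  using assms
  by (induction i rule: normalizer_induct)
    (simp add: normalizer_def, simp add: normalizer_step algebra_simps)

lemma normalizer_scale:
  assumes "1 \<le> i"
  shows "normalizer l (\<lambda>i j. c * A i j) i = c * normalizer l A i"
  using assms
  by (induction i rule: normalizer_induct)
    (simp add: normalizer_def, simp add: normalizer_step algebra_simps)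

lemma normalizer_eq_0:
  assumes "\<And>i. 1 \<le> i \<Longrightarrow> A 1 i = 0" "1 \<le> i"
  shows "normalizer l A i = 0"
  using assms(2)
  by (induction i rule: normalizer_induct)
    (simp add: normalizer_def, simp add: normalizer_step assms)

lemma normalizer_cong:
  assumes "\<And>i. 1 \<le> i \<Longrightarrow> A 1 i = B 1 i" "1 \<le> i"
  shows "normalizer l A i = normalizer l B i"
  using assms(2)
  by (induction i rule: normalizer_induct)
    (simp add: normalizer_def, simp add: normalizer_step assms)

definition normalized :: "int \<Rightarrow> (int \<Rightarrow> int \<Rightarrow> 'k::field) \<Rightarrow> int \<Rightarrow> int \<Rightarrow> 'k" where
  "normalized l A i j = A i j - coboundary_coeff l (normalizer l A) i j"

lemma normalized_cocycle:
  fixes A :: "int \<Rightarrow> int \<Rightarrow> 'k::field_char_0"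
  assumes A: "cocycle_coeff l A"
  shows "cocycle_coeff l (normalized l A)" and "1 \<le> i \<Longrightarrow> normalized l A 1 i = 0"
proof -
  have "cocycle_coeff l (coboundary_coeff l (normalizer l A))"
    by (rule cocycle_coboundary_coeff) (rule normalizer_low[OF A])
  then show "cocycle_coeff l (normalized l A)"
    unfolding normalized_def[abs_def] by (rule cocycle_coeff_diff[OF A])
  show "normalized l A 1 i = 0" if "1 \<le> i"
    using normalizer_normalizes[OF A that] by (simp add: normalized_def)
qed

lemma normalized_add:
  assumes "1 \<le> i" "1 \<le> j"
  shows "normalized l (\<lambda>i j. A i j + B i j) i j = normalized l A i j + normalized l B i j"
  using assms by (simp add: normalized_def coboundary_coeff_def normalizer_add algebra_simps)

lemma normalized_scale:
  assumes "1 \<le> i" "1 \<le> j"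
  shows "normalized l (\<lambda>i j. c * A i j) i j = c * normalized l A i j"
  using assms by (simp add: normalized_def coboundary_coeff_def normalizer_scale algebra_simps)

lemma normalized_idem:
  assumes "\<And>i. 1 \<le> i \<Longrightarrow> A 1 i = 0" "1 \<le> i" "1 \<le> j"
  shows "normalized l A i j = A i j"
  using assms(2,3) normalizer_eq_0[of A, OF assms(1)]
  by (simp add: normalized_def coboundary_coeff_def)

lemma normalized_cong:
  assumes "\<And>i j. 1 \<le> i \<Longrightarrow> 1 \<le> j \<Longrightarrow> A i j = B i j" "1 \<le> i" "1 \<le> j"
  shows "normalized l A i j = normalized l B i j"
  using assms normalizer_cong[of A B]
  by (simp add: normalized_def coboundary_coeff_def)

section \<open>Rigidity of normalised cocycles\<close>

lemma normalized_recursion_1: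
  assumes A: "cocycle_coeff l A" and n: "\<And>i. 1 \<le> i \<Longrightarrow> A 1 i = 0"
    and "2 \<le> j" "2 \<le> k"
  shows "sc 1 (j + k + l) * A j k = A (j + 1) k + A j (k + 1)"
proof -
  have "A (k + 1) j = - A j (k + 1)" "A (j + k) 1 = 0"
    using cocycle_coeff_antisym[OF A, of j "k+1"] cocycle_coeff_antisym[OF A, of 1 "j+k"]
      n[of "j+k"] assms by auto
  moreover have "sc 1 j = (1::'a)" "sc 1 k = (1::'a)" using assms by (auto simp: sc_def)
  ultimately show ?thesis
    using cocycle_coeff_eq[OF A, of 1 j k] assms n[of j] n[of k]
    by (simp add: cocycle_eq_def algebra_simps)
qed

lemma cocycle_recursion_2:
  assumes A: "cocycle_coeff l A" and "3 \<le> j" "3 \<le> k"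
  shows "sc 2 (j + k + l) * A j k - sc j (k + 2 + l) * A 2 k + sc k (j + 2 + l) * A 2 j
     = A (j + 2) k + A j (k + 2)"
proof -
  have "A (k + 2) j = - A j (k + 2)"
    using cocycle_coeff_antisym[OF A, of j "k+2"] assms by auto
  moreover have "sc 2 j = (1::'a)" "sc 2 k = (1::'a)" "sc j k = (0::'a)"
    using assms by (auto simp: sc_def)
  ultimately show ?thesis
    using cocycle_coeff_eq[OF A, of 2 j k] assms
    by (simp add: cocycle_eq_def algebra_simps)
qed

text \<open>On the span of \<open>e\<^sub>m\<close>, \<open>m \<ge> 3\<close>, brackets with \<open>e\<^sub>1\<close> and \<open>e\<^sub>2\<close> are shifts by \<open>1\<close> and \<open>2\<close>, and all other
  brackets vanish. Only entries with target \<open>e\<^sub>1\<close> or \<open>e\<^sub>2\<close> can disturb the two recursions; once these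
  are \<open>0\<close>, the recursions hold without restriction.\<close>

lemma normalized_cocycle_zero_if_low:
  fixes A :: "int \<Rightarrow> int \<Rightarrow> 'k::field_char_0"
  assumes A: "cocycle_coeff l A" and n: "\<And>i. 1 \<le> i \<Longrightarrow> A 1 i = 0"
    and low: "\<And>j k. 2 \<le> j \<Longrightarrow> 2 \<le> k \<Longrightarrow> j + k + l \<le> 2 \<Longrightarrow> A j k = 0"
    and "A 2 3 = 0" "A 3 4 = 0" and "1 \<le> i" "1 \<le> j"
  shows "A i j = 0"
proof -
  note anti = cocycle_coeff_antisym[OF A]
  have e1: "A j k = A (j + 1) k + A j (k + 1)" if "2 \<le> j" "2 \<le> k" for j k
    using normalized_recursion_1[OF A n, of j k] low[of j k] that
    by (cases "j + k + l \<ge> 2") (auto simp: sc_def)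
  have low2: "sc j (k + 2 + l) * A 2 k = 0" if "3 \<le> j" "3 \<le> k" for j k
    using low[of 2 k] that by (auto simp: sc_def)
  have e2: "A j k = A (j + 2) k + A j (k + 2)" if "3 \<le> j" "3 \<le> k" for j k
    using cocycle_recursion_2[OF A, of j k] low2[of j k] low2[of k j] low[of j k] that
    by (cases "j + k + l \<ge> 3") (auto simp: sc_def)
  \<comment> \<open>Applying \<open>e1\<close> twice gives \<open>A = S\<^sup>2 A + 2 S T A + T\<^sup>2 A\<close>, and \<open>e2\<close> cancels the squares.\<close>
  have diag: "A (j + 1) (k + 1) = 0" if "3 \<le> j" "3 \<le> k" for j k
  proof -
    have "A j k = A (j + 2) k + 2 * A (j + 1) (k + 1) + A j (k + 2)"
      using e1[of j k] e1[of "j + 1" k] e1[of j "k + 1"] that by (simp add: algebra_simps)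
    then show ?thesis using e2[OF that] by simp
  qed
  have ge4: "A j k = 0" if "4 \<le> j" "4 \<le> k" for j k
    using diag[of "j - 1" "k - 1"] that by simp
  have row3': "A 3 k = 0" if "4 \<le> k" for k
    using that
  proof (induction k rule: int_ge_induct)
    case (step k)
    then show ?case using e1[of 3 k] ge4[of 4 k] by simp
  qed (use assms in simp)
  have row3: "A 3 k = 0" if "3 \<le> k" for k
    using that row3'[of k] cocycle_coeff_self[OF A, of 3] by (cases "k = 3") auto
  have row2': "A 2 k = 0" if "3 \<le> k" for k
    using that
  proof (induction k rule: int_ge_induct)
    case (step k)
    then show ?case using e1[of 2 k] row3[of k] by simp
  qed (use assms in simp)
  have row2: "A 2 k = 0" if "2 \<le> k" for k
    using that row2'[of k] cocycle_coeff_self[OF A, of 2] by (cases "k = 2") auto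
  have upper: "A i j = 0" if ij: "1 \<le> i" "i \<le> j" for i j
  proof -
    consider "i = 1" | "i = 2" | "i = 3" | "4 \<le> i" using ij by linarith
    then show ?thesis using n[of j] row2[of j] row3[of j] ge4[of i j] ij by cases auto
  qed
  show ?thesis
    using upper[of i j] upper[of j i] anti[of i j] assms by (cases "i \<le> j") auto
qed

text \<open>For \<open>l \<ge> -4\<close> the entries with target \<open>0\<close>, \<open>e\<^sub>1\<close> or \<open>e\<^sub>2\<close> are, off the diagonal and up to sign,
  among \<open>A 2 3\<close> and \<open>A 2 4\<close>, and \<open>A 2 4\<close> is a multiple of \<open>A 2 3\<close>.\<close>

lemma normalized_cocycle_zero:
  fixes A :: "int \<Rightarrow> int \<Rightarrow> 'k::field_char_0"
  assumes A: "cocycle_coeff l A" and n: "\<And>i. 1 \<le> i \<Longrightarrow> A 1 i = 0"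
    and "-4 \<le> l" "A 2 3 = 0" "A 3 4 = 0" and "1 \<le> i" "1 \<le> j"
  shows "A i j = 0"
proof (rule normalized_cocycle_zero_if_low[OF A n])
  fix j k :: int assume jk: "2 \<le> j" "2 \<le> k" "j + k + l \<le> 2"
  have self: "A 2 2 = 0" "A 3 3 = 0" using cocycle_coeff_self[OF A] by auto
  have "A 2 4 = 0"
    using normalized_recursion_1[OF A n, of 2 3] assms self by simp
  moreover have "A 3 2 = 0" "A 4 2 = - A 2 4"
    using cocycle_coeff_antisym[OF A, of 2 3] cocycle_coeff_antisym[OF A, of 2 4] assms by auto
  moreover have "(j, k) \<in> {(2,2), (2,3), (2,4), (3,2), (3,3), (4,2)}"
    using jk assms by auto
  ultimately show "A j k = 0" using self assms by auto
qed (use assms in auto)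

text \<open>If \<open>j, k \<ge> 3\<close> and \<open>\<omega> (e\<^sub>j, e\<^sub>k)\<close> is a multiple of \<open>e\<^sub>1\<close> or \<open>e\<^sub>2\<close>, then its bracket with \<open>e\<^sub>m\<close> for
  large \<open>m\<close> is the only term of the cocycle equation of \<open>(e\<^sub>j, e\<^sub>k, e\<^sub>m)\<close>. This kills all entries
  \<open>A j k\<close> with such a target, for \<open>l \<le> -5\<close> including \<open>A 3 4\<close>;
  the row \<open>A 2 k\<close> follows by one step of the first recursion.\<close>

lemma normalized_cocycle_zero_if_le_minus_5:
  fixes A :: "int \<Rightarrow> int \<Rightarrow> 'k::field_char_0"
  assumes A: "cocycle_coeff l A" and n: "\<And>i. 1 \<le> i \<Longrightarrow> A 1 i = 0"
    and l: "l \<le> -5" and "1 \<le> i" "1 \<le> j"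
  shows "A i j = 0"
proof -
  have low3: "A j k = 0" if jk: "3 \<le> j" "3 \<le> k" "j + k + l \<le> 2" for j k
  proof (cases "j + k + l \<le> 0")
    case True
    then show ?thesis using cocycle_coeff_low[OF A] jk by auto
  next
    case False
    \<comment> \<open>\<open>m\<close> is so large that \<open>j + m + l\<close> and \<open>k + m + l\<close> are at least \<open>3\<close>.\<close>
    define m where "m = j + k + 3 - l"
    have "sc m (j + k + l) = (-1::'k)" "sc j (k + m + l) = (0::'k)" "sc k (j + m + l) = (0::'k)"
      "sc j k = (0::'k)" "sc j m = (0::'k)" "sc k m = (0::'k)"
      using False jk l by (auto simp: sc_def m_def)
    then show ?thesis
      using cocycle_coeff_eq[OF A, of j k m] jk l
      by (simp add: cocycle_eq_def m_def)
  qed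
  have low2: "A 2 k = 0" if k: "2 \<le> k" "k + 2 + l \<le> 2" for k
  proof -
    consider "k + 2 + l \<le> 0" | "k = 2" | "3 < k" "1 \<le> k + 2 + l" using k l by linarith
    then show ?thesis
    proof cases
      case 3
      have "sc 1 (2 + (k - 1) + l) = (0::'k)" using k by (simp add: sc_def)
      then show ?thesis
        using normalized_recursion_1[OF A n, of 2 "k - 1"] low3[of 3 "k - 1"] 3 k by simp
    qed (use cocycle_coeff_low[OF A, of 2 k] cocycle_coeff_self[OF A, of 2] k in auto)
  qed
  have low: "A j k = 0" if jk: "2 \<le> j" "2 \<le> k" "j + k + l \<le> 2" for j k
  proof -
    consider "j = 2" | "k = 2" | "3 \<le> j" "3 \<le> k" using jk by linarith
    then show ?thesis
      using low2[of k] low2[of j] low3[of j k] cocycle_coeff_antisym[OF A, of 2 j] jk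
      by cases (auto simp: add.commute)
  qed
  show ?thesis
    by (rule normalized_cocycle_zero_if_low[OF A n low]) (use low[of 2 3] low[of 3 4] assms in auto)
qed

section \<open>Coboundaries that are normalised\<close>

text \<open>The condition \<open>n\<close> computes \<open>b 3\<close>, \<open>b 4\<close>, \<open>b 5\<close> from \<open>b 1\<close> and \<open>b 2\<close>, and the two entries
  involve no other values of \<open>b\<close>. The weights below \<open>2\<close> differ in which of the structure constants
  vanish.\<close>

lemma normalized_coboundary_zero:
  fixes b :: "int \<Rightarrow> 'k::field"
  assumes low: "\<And>i. 1 \<le> i \<Longrightarrow> i + l \<le> 0 \<Longrightarrow> b i = 0" and "-4 \<le> l"
    and n: "\<And>i. 1 \<le> i \<Longrightarrow> coboundary_coeff l b 1 i = 0"
  shows "coboundary_coeff l b 3 4 = 0"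
    and "l \<notin> {-1, 0, 1} \<Longrightarrow> coboundary_coeff l b 2 3 = 0"
proof -
  consider "l = -4" | "l = -3" | "l = -2" | "l = -1" | "l = 0" | "l = 1" | "2 \<le> l"
    using assms by linarith
  note cases = this
  show "coboundary_coeff l b 3 4 = 0"
    using cases n[of 2] n[of 3] low[of 1] low[of 2] low[of 3] low[of 4]
    by cases (simp_all add: coboundary_coeff_def sc_def)
  show "coboundary_coeff l b 2 3 = 0" if "l \<notin> {-1, 0, 1}"
    using cases n[of 2] n[of 3] n[of 4] low[of 1] low[of 2] low[of 3] low[of 4] that
    by cases (simp_all add: coboundary_coeff_def sc_def)
qed

text \<open>For \<open>l = 0\<close> and \<open>l = 1\<close> the solutions come from the recursion
  \<open>b (i + 1) = b i + b 1\<close> that normalisation imposes; for \<open>l = -1\<close> only \<open>e\<^sub>2 \<mapsto> e\<^sub>1\<close> is available, and it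
  contributes through \<open>[e\<^sub>3, e\<^sub>1] = - e\<^sub>4\<close>.\<close>

lemma normalized_coboundary_exists:
  fixes d :: "'k::field_char_0"
  assumes "l \<in> {-1, 0, 1}"
  obtains b where "\<And>i. 1 \<le> i \<Longrightarrow> i + l \<le> 0 \<Longrightarrow> b i = 0"
    and "\<And>i. 1 \<le> i \<Longrightarrow> coboundary_coeff l b 1 i = 0"
    and "coboundary_coeff l b 2 3 = d"
proof -
  consider "l = -1" | "l = 0" | "l = 1" using assms by auto
  then show thesis
  proof cases
    case 1
    show thesis
      by (rule that[of "\<lambda>i. if i = 2 then d else 0"]) (auto simp: 1 coboundary_coeff_def sc_def)
  next
    case 2
    show thesis
      by (rule that[of "\<lambda>i. if 2 \<le> i then d else 0"]) (auto simp: 2 coboundary_coeff_def sc_def)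
  next
    case 3
    show thesis
      by (rule that[of "\<lambda>i. if i = 1 then - d / 2
            else if 3 \<le> i then - of_int (i - 3) * d / 2 else 0"])
        (auto simp: 3 coboundary_coeff_def sc_def field_simps)
  qed
qed

section \<open>Normalised cocycles with prescribed values\<close>

text \<open>The solution of the recursions with \<open>A 3 4 = c\<close> and \<open>A 2 3 = d\<close>. The correction \<open>f\<close> is the
  constant value of the row \<open>A 4 k\<close>: for \<open>l = -3\<close> and \<open>l = -4\<close> the term \<open>[e\<^sub>k, \<omega> (e\<^sub>2, e\<^sub>3)]\<close> of the
  equation of \<open>(e\<^sub>2, e\<^sub>3, e\<^sub>k)\<close> survives and forces \<open>2 f = d\<close>. Summing along the first recursion
  makes the row \<open>A 3 k\<close> affine and the row \<open>A 2 k\<close> quadratic in \<open>k\<close>. The value \<open>d'\<close> of \<open>A 2 4\<close>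
  vanishes for \<open>l = -4\<close>, where \<open>[e\<^sub>1, \<omega> (e\<^sub>2, e\<^sub>3)]\<close> is a multiple of \<open>[e\<^sub>1, e\<^sub>1]\<close>.\<close>

definition normal_form_upper :: "int \<Rightarrow> 'k::field_char_0 \<Rightarrow> 'k \<Rightarrow> int \<Rightarrow> int \<Rightarrow> 'k" where
  "normal_form_upper l c d i j =
    (let f = (if l \<le> -3 then d / 2 else 0); d' = (if l = -4 then 0 else d); t = of_int j in
     if i = 2 then
       (if j = 3 then d else if j = 4 then d' else d' - (t - 4) * c + f * ((t - 5) * (t - 6) / 2))
     else if i = 3 then (if j = 4 then c else c - (t - 5) * f)
     else if i = 4 then f else 0)"

definition normal_form :: "int \<Rightarrow> 'k::field_char_0 \<Rightarrow> 'k \<Rightarrow> int \<Rightarrow> int \<Rightarrow> 'k" where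
  "normal_form l c d i j =
    (if 2 \<le> i \<and> i < j then normal_form_upper l c d i j
     else if 2 \<le> j \<and> j < i then - normal_form_upper l c d j i else 0)"

lemma normal_form_values:
  "normal_form l c d 1 i = 0" "normal_form l c d 2 3 = d" "normal_form l c d 3 4 = c"
  by (auto simp: normal_form_def normal_form_upper_def)

lemma cocycle_normal_form:
  fixes c d :: "'k::field_char_0"
  assumes l: "-4 \<le> l"
  shows "cocycle_coeff l (normal_form l c d)"
proof -
  define A where "A = normal_form l c d"
  define f where "f = (if l \<le> -3 then d / 2 else 0)"
  define d' where "d' = (if l = -4 then 0 else d)"
  have one: "A 1 k = 0" "A k 1 = 0" and diag: "A k k = 0" for k
    by (auto simp: A_def normal_form_def)
  have anti: "A k j = - A j k" for j k
    by (auto simp: A_def normal_form_def)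
  have A23: "A 2 3 = d" and A24: "A 2 4 = d'" and A34: "A 3 4 = c"
    by (simp_all add: A_def normal_form_def normal_form_upper_def d'_def)
  have row2: "A 2 k = d' - of_int (k - 4) * c + f * (of_int (k - 5) * of_int (k - 6) / 2)"
    and row3: "A 3 k = c - of_int (k - 5) * f" and row4: "A 4 k = f" if "5 \<le> k" for k
    using that by (auto simp: A_def normal_form_def normal_form_upper_def d'_def f_def Let_def)
  have rest: "A j k = 0" if "5 \<le> j" "5 \<le> k" for j k
    using that by (auto simp: A_def normal_form_def normal_form_upper_def)
  have E1: "sc 1 (j + k + l) * A j k = A (j + 1) k + A j (k + 1)" if jk: "2 \<le> j" "j < k" for j k
  proof -
    have d': "sc 1 (5 + l) * d = d'" using l by (auto simp: sc_def d'_def)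
    have "A j k = A (j + 1) k + A j (k + 1)" if "k \<noteq> 3"
    proof -
      consider "j = 2" "k = 4" | "j = 2" "5 \<le> k"
        | "j = 3" "k = 4" | "j = 3" "5 \<le> k" | "j = 4" "k = 5" | "j = 4" "6 \<le> k" | "5 \<le> j"
        using jk \<open>k \<noteq> 3\<close> by linarith
      then show ?thesis
      proof cases
        case 2
        then show ?thesis by (simp add: row2 row3) (simp add: field_simps)
      qed (use jk in \<open>simp_all add: A24 A34 row2 row3 row4 rest diag algebra_simps\<close>)
    qed
    moreover have "sc 1 (j + k + l) = (1::'k)" if "k \<noteq> 3"
      using that jk l by (simp add: sc_def)
    moreover have "j = 2" if "k = 3" using that jk by simp
    ultimately show ?thesis
      using d' A23 A24 diag[of 3] by (cases "k = 3") simp_all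
  qed
  have E2: "sc 2 (j + k + l) * A j k - sc j (k + 2 + l) * A 2 k + sc k (j + 2 + l) * A 2 j
     = A (j + 2) k + A j (k + 2)" if jk: "3 \<le> j" "j < k" for j k
  proof -
    have br1: "sc 2 (j + k + l) = (1::'k)" using jk l by (simp add: sc_def)
    \<comment> \<open>The only nonzero structure constant here occurs for \<open>l = -4\<close>, together with \<open>A 2 4 = d' = 0\<close>.\<close>
    have z: "sc j (k + 2 + l) * A 2 k = 0"
      using jk l A24 by (cases "k = 4 \<and> l = -4") (auto simp: sc_def d'_def)
    consider "j = 3" "k = 4" | "j = 3" "5 \<le> k" | "j = 4" "k = 5" | "j = 4" "6 \<le> k" | "5 \<le> j"
      using jk by linarith
    then show ?thesis
    proof cases
      case 1
      have "sc k (j + 2 + l) * A 2 j = - 2 * f"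
        using 1 l A23 by (auto simp: sc_def f_def)
      then show ?thesis using 1 br1 z anti[of 4 5] by (simp add: A34 row3 row4)
    next
      case 2
      have "sc k (j + 2 + l) * A 2 j = - 2 * f"
        using 2 l A23 by (auto simp: sc_def f_def)
      then show ?thesis using 2 br1 z by (simp add: rest row3 algebra_simps)
    next
      case 3
      have "sc k (j + 2 + l) * A 2 j = 0"
        using 3 l A24 by (auto simp: sc_def d'_def)
      then show ?thesis using 3 br1 z by (auto simp: row4 rest)
    next
      case 4
      have "sc k (j + 2 + l) * A 2 j = 0"
        using 4 l A24 by (auto simp: sc_def d'_def)
      then show ?thesis using 4 br1 z by (auto simp: row4 rest)
    next
      case 5
      have "sc k (j + 2 + l) * A 2 j = 0"
        using 5 jk l by (simp add: sc_def)
      then show ?thesis using 5 jk br1 z by (auto simp: rest)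
    qed
  qed
  have "cocycle_coeff l A"
  proof (rule cocycle_coeffI)
    fix i j :: int
    assume "1 \<le> i" "1 \<le> j" "i + j + l \<le> 0"
    then show "A i j = 0" using l by (auto simp: A_def normal_form_def)
  next
    fix i j k :: int
    assume ijk: "1 \<le> i" "i < j" "j < k"
    consider "i = 1" | "i = 2" | "3 \<le> i" using ijk by linarith
    then show "cocycle_eq l A i j k = 0"
    proof cases
      case 1
      then have "sc 1 j = (1::'k)" "sc 1 k = (1::'k)" using ijk by (simp_all add: sc_def)
      then show ?thesis
        using 1 ijk E1[of j k] anti[of j "k + 1"] one
        by (simp add: cocycle_eq_def algebra_simps)
    next
      case 2
      then have "sc 2 j = (1::'k)" "sc 2 k = (1::'k)" "sc j k = (0::'k)"
        using ijk by (simp_all add: sc_def)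
      then show ?thesis
        using 2 ijk E2[of j k] anti[of j "k + 2"]
        by (simp add: cocycle_eq_def algebra_simps)
    next
      case 3
      then show ?thesis using ijk l by (simp add: cocycle_eq_def sc_def)
    qed
  qed (rule anti)
  then show ?thesis by (simp add: A_def)
qed

section \<open>The dimension of the cohomology\<close>

text \<open>Normalisation does not change the cohomology class.\<close>

lemma is_coboundary_coeffI:
  assumes A: "cocycle_coeff l A"
    and b: "\<And>i. 1 \<le> i \<Longrightarrow> i + l \<le> 0 \<Longrightarrow> b i = 0"
    and eq: "\<And>i j. 1 \<le> i \<Longrightarrow> 1 \<le> j \<Longrightarrow> normalized l A i j = coboundary_coeff l b i j"
  shows "is_coboundary_coeff l A"
  unfolding is_coboundary_coeff_def
proof (intro exI conjI allI impI)
  fix i j :: int assume "1 \<le> i"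
  show "normalizer l A i + b i = 0" if "i + l \<le> 0"
    using that \<open>1 \<le> i\<close> b normalizer_low[OF A] by simp
  show "A i j = coboundary_coeff l (\<lambda>i. normalizer l A i + b i) i j" if "1 \<le> j"
    using eq[OF \<open>1 \<le> i\<close> that] by (simp add: normalized_def coboundary_coeff_add algebra_simps)
qed

lemma is_coboundary_coeff_if_le_minus_5:
  fixes A :: "int \<Rightarrow> int \<Rightarrow> 'k::field_char_0"
  assumes A: "cocycle_coeff l A" and l: "l \<le> -5"
  shows "is_coboundary_coeff l A"
proof (rule is_coboundary_coeffI[OF A, of "\<lambda>_. 0"])
  fix i j :: int assume "1 \<le> i" "1 \<le> j"
  then show "normalized l A i j = coboundary_coeff l (\<lambda>_. 0) i j"
    using normalized_cocycle_zero_if_le_minus_5[OF normalized_cocycle[OF A] l, of i j]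
    by (simp add: coboundary_coeff_def)
qed simp

lemma is_coboundary_coeff_iff:
  fixes A :: "int \<Rightarrow> int \<Rightarrow> 'k::field_char_0"
  assumes A: "cocycle_coeff l A" and l: "-4 \<le> l"
  shows "is_coboundary_coeff l A \<longleftrightarrow>
    normalized l A 3 4 = 0 \<and> (l \<in> {-1, 0, 1} \<or> normalized l A 2 3 = 0)"
proof
  assume "is_coboundary_coeff l A"
  then obtain b where b: "\<And>i. 1 \<le> i \<Longrightarrow> i + l \<le> 0 \<Longrightarrow> b i = 0"
    and eq: "\<And>i j. 1 \<le> i \<Longrightarrow> 1 \<le> j \<Longrightarrow> A i j = coboundary_coeff l b i j"
    unfolding is_coboundary_coeff_def by blast
  let ?b = "\<lambda>i. b i - normalizer l A i"
  have N: "normalized l A i j = coboundary_coeff l ?b i j" if "1 \<le> i" "1 \<le> j" for i j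
    using eq[OF that] by (simp add: normalized_def coboundary_coeff_diff)
  have low: "?b i = 0" if "1 \<le> i" "i + l \<le> 0" for i
    using b[OF that] normalizer_low[OF A that] by simp
  have n: "coboundary_coeff l ?b 1 i = 0" if "1 \<le> i" for i
    using N[of 1 i] normalized_cocycle(2)[OF A that] that by simp
  show "normalized l A 3 4 = 0 \<and> (l \<in> {-1, 0, 1} \<or> normalized l A 2 3 = 0)"
    using normalized_coboundary_zero[of l ?b, OF low l n] N[of 3 4] N[of 2 3] by auto
next
  assume *: "normalized l A 3 4 = 0 \<and> (l \<in> {-1, 0, 1} \<or> normalized l A 2 3 = 0)"
  \<comment> \<open>\<open>b\<close> removes the entry \<open>2 3\<close>, which is not determined by the class if \<open>l \<in> {-1, 0, 1}\<close>.\<close>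
  obtain b where b: "\<And>i. 1 \<le> i \<Longrightarrow> i + l \<le> 0 \<Longrightarrow> b i = 0"
    "\<And>i. 1 \<le> i \<Longrightarrow> coboundary_coeff l b 1 i = 0"
    "coboundary_coeff l b 2 3 = normalized l A 2 3"
  proof (cases "l \<in> {-1, 0, 1}")
    case True
    then show thesis using normalized_coboundary_exists that by blast
  next
    case False
    show thesis by (rule that[of "\<lambda>_. 0"]) (use * False in \<open>simp_all add: coboundary_coeff_def\<close>)
  qed
  let ?B = "\<lambda>i j. normalized l A i j - coboundary_coeff l b i j"
  have B: "cocycle_coeff l ?B"
    by (rule cocycle_coeff_diff[OF normalized_cocycle(1)[OF A] cocycle_coboundary_coeff])
      (rule b(1))
  have "coboundary_coeff l b 3 4 = 0"
    by (rule normalized_coboundary_zero(1)[of l b, OF b(1) l b(2)])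
  then have "?B i j = 0" if "1 \<le> i" "1 \<le> j" for i j
    using normalized_cocycle_zero[OF B _ l, of i j] that b * normalized_cocycle(2)[OF A] by simp
  then show "is_coboundary_coeff l A"
    by (intro is_coboundary_coeffI[OF A b(1)]) auto
qed

lemma module_m2_cocycles:
  "module class_ring (m2_cocycles l :: ('k::field_char_0, _) module)"
proof -
  let ?Z = "m2_cocycles l :: ('k, _) module"
  have lin: "m2_cochain2 (\<lambda>x y. \<omega> x y + m2_scale c (\<eta> x y))"
    if "m2_cochain2 \<omega>" "m2_cochain2 \<eta>" for \<omega> \<eta> :: "'k m2 \<Rightarrow> 'k m2 \<Rightarrow> 'k m2" and c
    unfolding m2_cochain2_def
    by (intro conjI allI m2_linearI; simp add: m2_cochain2_simps[OF that(1)]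
      m2_cochain2_simps[OF that(2)] m2.scale_right_distrib mult.commute)
  have wt: "m2_weight2 l (\<lambda>x y. \<omega> x y + m2_scale c (\<eta> x y))"
    if w: "m2_weight2 l \<omega>" "m2_weight2 l \<eta>" for \<omega> \<eta> :: "'k m2 \<Rightarrow> 'k m2 \<Rightarrow> 'k m2" and c
    unfolding m2_weight2_def
  proof (intro allI impI)
    fix i j :: int assume "1 \<le> i" "1 \<le> j"
    then show "\<exists>a. \<omega> (m2_e i) (m2_e j) + m2_scale c (\<eta> (m2_e i) (m2_e j))
        = m2_scale a (m2_e (i + j + l))"
      by (intro exI[of _ "coeff2 l \<omega> i j + c * coeff2 l \<eta> i j"])
        (simp add: coeff2_e[OF w(1)] coeff2_e[OF w(2)] m2.scale_left_distrib)
  qed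
  have d2: "m2_d2 (\<lambda>x y. \<omega> x y + m2_scale c (\<eta> x y)) x y z
      = m2_d2 \<omega> x y z + m2_scale c (m2_d2 \<eta> x y z)"
    for \<omega> \<eta> :: "'k m2 \<Rightarrow> 'k m2 \<Rightarrow> 'k m2" and c x y z
    by (simp add: m2_d2_def m2_bracket_simps m2.scale_right_distrib m2.scale_right_diff_distrib)
  have comb: "(\<lambda>x y. \<omega> x y + m2_scale c (\<eta> x y)) \<in> carrier ?Z"
    if "\<omega> \<in> carrier ?Z" "\<eta> \<in> carrier ?Z" for \<omega> \<eta> c
    using that lin wt d2 by (simp add: m2_cocycles_def)
  have zero: "(\<lambda>x y. 0) \<in> carrier ?Z"
    by (auto simp: m2_cocycles_def m2_cochain2_def m2_weight2_def m2_d2_def m2_bracket_zero_right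
        intro!: m2_linearI exI[of _ 0])
  have smult: "(\<lambda>x y. m2_scale c (\<omega> x y)) \<in> carrier ?Z" if "\<omega> \<in> carrier ?Z" for \<omega> c
    using comb[OF zero that, of c] by simp
  have add: "(\<lambda>x y. \<omega> x y + \<eta> x y) \<in> carrier ?Z" if "\<omega> \<in> carrier ?Z" "\<eta> \<in> carrier ?Z" for \<omega> \<eta>
    using comb[OF that, of 1] by simp
  have ops: "\<omega> \<oplus>\<^bsub>?Z\<^esub> \<eta> = (\<lambda>x y. \<omega> x y + \<eta> x y)" "c \<odot>\<^bsub>?Z\<^esub> \<omega> = (\<lambda>x y. m2_scale c (\<omega> x y))"
    "\<zero>\<^bsub>?Z\<^esub> = (\<lambda>x y. 0)" for \<omega> \<eta> c
    by (simp_all add: m2_cocycles_def)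
  show ?thesis
  proof (rule module_criteria)
    show "cring (class_ring :: 'k ring)" by (rule class_cring.cring_axioms)
    show "\<forall>v\<in>carrier ?Z. \<exists>u\<in>carrier ?Z. v \<oplus>\<^bsub>?Z\<^esub> u = \<zero>\<^bsub>?Z\<^esub>"
    proof
      fix v assume "v \<in> carrier ?Z"
      then show "\<exists>u\<in>carrier ?Z. v \<oplus>\<^bsub>?Z\<^esub> u = \<zero>\<^bsub>?Z\<^esub>"
        using smult[of v "-1"]
        by (intro bexI[of _ "\<lambda>x y. m2_scale (-1) (v x y)"]) (simp_all add: ops)
    qed
  qed (simp_all add: ops zero add smult fun_eq_iff algebra_simps m2.scale_right_distrib
      m2.scale_left_distrib)
qed

text \<open>Linear functionals on coefficient arrays that cut out the coboundaries and are jointly surjective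
  are coordinates on the cohomology.\<close>

lemma has_dim_m2_H2I:
  fixes l :: int and e :: "nat \<Rightarrow> (int \<Rightarrow> int \<Rightarrow> 'k::field_char_0) \<Rightarrow> 'k"
  assumes cong: "\<And>i A B. (\<And>i j. 1 \<le> i \<Longrightarrow> 1 \<le> j \<Longrightarrow> A i j = B i j) \<Longrightarrow> e i A = e i B"
    and add: "\<And>i A B. e i (\<lambda>p q. A p q + B p q) = e i A + e i B"
    and scale: "\<And>i c A. e i (\<lambda>p q. c * A p q) = c * e i A"
    and ker: "\<And>A. cocycle_coeff l A \<Longrightarrow> is_coboundary_coeff l A \<longleftrightarrow> (\<forall>i<n. e i A = 0)"
    and surj: "\<And>v. \<exists>A. cocycle_coeff l A \<and> (\<forall>i<n. e i A = v i)"
  shows "has_dim (m2_H2 l :: ('k, _) module) n"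
proof -
  let ?Z = "m2_cocycles l :: ('k, _) module"
  let ?V = "module_vec TYPE('k) n"
  define F where "F \<omega> = vec n (\<lambda>i. e i (coeff2 l \<omega>))" for \<omega> :: "'k m2 \<Rightarrow> 'k m2 \<Rightarrow> 'k m2"
  have coeff_add: "coeff2 l (\<lambda>x y. \<omega> x y + \<eta> x y) = (\<lambda>i j. coeff2 l \<omega> i j + coeff2 l \<eta> i j)"
    and coeff_scale: "coeff2 l (\<lambda>x y. m2_scale c (\<omega> x y)) = (\<lambda>i j. c * coeff2 l \<omega> i j)"
    for \<omega> \<eta> :: "'k m2 \<Rightarrow> 'k m2 \<Rightarrow> 'k m2" and c
    by (simp_all add: coeff2_def fun_eq_iff)
  have "linear_map class_ring ?Z ?V F"
    using module_m2_cocycles[where ?'k = 'k, of l] vec_module[where ?'a = 'k, of n]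
      class_field[where ?'a = 'k]
    by (auto simp: linear_map_def mod_hom_def mod_hom_axioms_def LinearCombinations.module_hom_def
        vectorspace_def module_vec_simps F_def m2_cocycles_def coeff_add coeff_scale add scale)
  moreover have "F ` carrier ?Z = carrier_vec n"
  proof (intro equalityI subsetI)
    fix v :: "'k vec" assume v: "v \<in> carrier_vec n"
    obtain A where A: "cocycle_coeff l A" "\<And>i. i < n \<Longrightarrow> e i A = v $ i"
      using surj[of "($) v"] by blast
    have "F (cochain2_of l A) = v"
      using v A(2) cong[of "coeff2 l (cochain2_of l A)" A, OF cocycle_cochain2_of(2)[OF A(1)]]
      by (intro eq_vecI) (auto simp: F_def)
    then show "v \<in> F ` carrier ?Z" using cocycle_cochain2_of(1)[OF A(1)] by blast
  qed (auto simp: F_def)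
  moreover have "m2_coboundaries l = {\<omega> \<in> carrier ?Z. F \<omega> = 0\<^sub>v n}"
  proof -
    have "\<omega> \<in> m2_coboundaries l \<longleftrightarrow> F \<omega> = 0\<^sub>v n" if "\<omega> \<in> carrier ?Z" for \<omega>
      using m2_coboundaries_iff[OF that] ker[OF coeff2_cocycle[OF that]]
      by (auto simp: F_def vec_eq_iff)
    then show ?thesis using m2_coboundaries_subset[where ?'k = 'k, of l] by blast
  qed
  ultimately show ?thesis unfolding m2_H2_def by (rule has_dim_quotient_module)
qed

lemma has_dim_m2_H2:
  "l \<le> -5 \<Longrightarrow> has_dim (m2_H2 l :: ('k::field_char_0, _) module) 0"
  "l \<in> {-1, 0, 1} \<Longrightarrow> has_dim (m2_H2 l :: ('k::field_char_0, _) module) 1"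
  "l \<in> {-4, -3, -2} \<or> 2 \<le> l \<Longrightarrow> has_dim (m2_H2 l :: ('k::field_char_0, _) module) 2"
proof -
  define e :: "nat \<Rightarrow> (int \<Rightarrow> int \<Rightarrow> 'k) \<Rightarrow> 'k"
    where "e i A = (if i = 0 then normalized l A 3 4 else normalized l A 2 3)" for i A
  have e: "(\<And>i j. 1 \<le> i \<Longrightarrow> 1 \<le> j \<Longrightarrow> A i j = B i j) \<Longrightarrow> e n A = e n B"
    "e n (\<lambda>p q. A p q + B p q) = e n A + e n B"
    "e n (\<lambda>p q. c * A p q) = c * e n A" for A B n c
    using normalized_cong[of A B] by (auto simp: e_def normalized_add normalized_scale)
  have less2: "i < 2 \<longleftrightarrow> i = 0 \<or> i = 1" for i :: nat by auto
  have surj: "\<exists>A. cocycle_coeff l A \<and> (\<forall>i<2. e i A = v i)" if "-4 \<le> l" for v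
    using cocycle_normal_form[OF that, of "v 0" "v 1"]
    by (intro exI[of _ "normal_form l (v 0) (v 1)"])
      (auto simp: e_def less2 normalized_idem normal_form_values)
  show "has_dim (m2_H2 l :: ('k, _) module) 0" if l: "l \<le> -5"
  proof (rule has_dim_m2_H2I[of e, OF e])
    fix A :: "int \<Rightarrow> int \<Rightarrow> 'k" assume "cocycle_coeff l A"
    then show "is_coboundary_coeff l A \<longleftrightarrow> (\<forall>i<0. e i A = 0)"
      using is_coboundary_coeff_if_le_minus_5[of l A] l by simp
  next
    have "cocycle_coeff l (\<lambda>_ _. 0 :: 'k)" by (simp add: cocycle_coeff_def cocycle_eq_def)
    then show "\<exists>A. cocycle_coeff l A \<and> (\<forall>i<0. e i A = v i)" for v by auto
  qed
  show "has_dim (m2_H2 l :: ('k, _) module) 1" if l: "l \<in> {-1, 0, 1}"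
  proof (rule has_dim_m2_H2I[of e, OF e])
    fix A :: "int \<Rightarrow> int \<Rightarrow> 'k" assume "cocycle_coeff l A"
    then show "is_coboundary_coeff l A \<longleftrightarrow> (\<forall>i<1. e i A = 0)"
      using is_coboundary_coeff_iff[of l A] l by (auto simp: e_def)
  next
    have "-4 \<le> l" using l by auto
    then have "\<exists>A. cocycle_coeff l A \<and> (\<forall>i<2. e i A = v i)" for v by (rule surj)
    moreover have "(\<forall>i<2. e i A = v i) \<Longrightarrow> (\<forall>i<1. e i A = v i)" 
      for A and v :: "nat \<Rightarrow> 'k" by simp
    ultimately show "\<exists>A. cocycle_coeff l A \<and> (\<forall>i<1. e i A = v i)" for v by blast
  qed
  show "has_dim (m2_H2 l :: ('k, _) module) 2" if l: "l \<in> {-4, -3, -2} \<or> 2 \<le> l"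
  proof (rule has_dim_m2_H2I[of e, OF e])
    fix A :: "int \<Rightarrow> int \<Rightarrow> 'k" assume "cocycle_coeff l A"
    then show "is_coboundary_coeff l A \<longleftrightarrow> (\<forall>i<2. e i A = 0)"
      using is_coboundary_coeff_iff[of l A] l by (auto simp: e_def less2)
  next
    show "\<exists>A. cocycle_coeff l A \<and> (\<forall>i<2. e i A = v i)" for v
      by (rule surj) (use l in auto)
  qed
qed

theorem theorem4:
  fixes l :: int
  shows "(l \<le> -5 \<longrightarrow>
            has_dim (m2_H2 l :: (real, _) module) 0 \<and>
            has_dim (m2_H2 l :: (complex, _) module) 0) \<and>
         (l \<in> {-1, 0, 1} \<longrightarrow>
            has_dim (m2_H2 l :: (real, _) module) 1 \<and>
            has_dim (m2_H2 l :: (complex, _) module) 1) \<and>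
         (l \<in> {-4, -3, -2} \<or> l \<ge> 2 \<longrightarrow>
            has_dim (m2_H2 l :: (real, _) module) 2 \<and>
            has_dim (m2_H2 l :: (complex, _) module) 2)"
  by (intro conjI impI has_dim_m2_H2)

end
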